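(* There exist a stable 2-coloring of pairs $f:[\omega]^2\to 2$ and a family $Y$ of infinite subsets of $\omega$ such that (i) for every $P\in Y$, no $(f\oplus P)$-computable set is homogeneous for $f$; and (ii) every stable 2-coloring of pairs $f':[\omega]^2\to 2$ with $f'\le_T f$ either has an $(f\oplus P)$-computable p-homogeneous set for some $P\in Y$, or else has some p-homogeneous set which computes no set homogeneous for $f$.
   Context: A 2-coloring of pairs is $f:[\omega]^2\to 2$, with $f(x,y)$ meaning $f(\{x,y\})$ for $x<y$; it is stable if $\lim_u f(x,u)$ exists for all $x$. $A\oplus B=\{2x:x\in A\}\cup\{2y+1:y\in B\}$. An infinite set $H$ is homogeneous for $f$ if $f$ is constant on $[H]^2$. A set $H=H_L\oplus H_R$ with $H_L,H_R$ infinite is p-homogeneous for a coloring $g$ if $g(\{x,y\})$ is constant over $x\in H_L$, $y\in H_R$, $x\neq y$. *)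

theory Defs
  imports Main "HOL-Library.Nat_Bijection"
begin

datatype rprog =
    Zero
  | Succ
  | Proj nat
  | Oracle
  | Comp rprog "rprog list"
  | Prec rprog rprog
  | Mn rprog

inductive reval :: "nat set \<Rightarrow> rprog \<Rightarrow> nat list \<Rightarrow> nat \<Rightarrow> bool" for A where
  zero: "reval A Zero xs 0"
| succ: "reval A Succ (x # xs) (Suc x)"
| proj: "i < length xs \<Longrightarrow> reval A (Proj i) xs (xs ! i)"
| orac: "reval A Oracle (x # xs) (if x \<in> A then 1 else 0)"
| comp: "list_all2 (\<lambda>g y. reval A g xs y) gs ys \<Longrightarrow> reval A f ys v \<Longrightarrow> reval A (Comp f gs) xs v"
| prec0: "reval A f xs v \<Longrightarrow> reval A (Prec f g) (0 # xs) v"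
| precS: "reval A (Prec f g) (n # xs) u \<Longrightarrow> reval A g (n # u # xs) v
          \<Longrightarrow> reval A (Prec f g) (Suc n # xs) v"
| mn: "reval A f (n # xs) 0 \<Longrightarrow> (\<forall>m<n. \<exists>v. reval A f (m # xs) (Suc v))
          \<Longrightarrow> reval A (Mn f) xs n"

definition turing_le :: "nat set \<Rightarrow> nat set \<Rightarrow> bool" (infix "\<le>\<^sub>T" 50) where
  "B \<le>\<^sub>T A \<longleftrightarrow> (\<exists>p. \<forall>x. reval A p [x] (if x \<in> B then 1 else 0))"

text \<open>A 2-coloring of pairs f : [omega]^2 -> 2 is represented by f :: nat => nat => bool, where
  f x y (for x < y) is the colour of {x,y}; values with x >= y are irrelevant.\<close>

definition join :: "nat set \<Rightarrow> nat set \<Rightarrow> nat set" (infixl "\<oplus>" 65) where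
  "A \<oplus> B = (\<lambda>x. 2 * x) ` A \<union> (\<lambda>y. 2 * y + 1) ` B"

definition col_set :: "(nat \<Rightarrow> nat \<Rightarrow> bool) \<Rightarrow> nat set" where
  "col_set f = {prod_encode (x, y) | x y. x < y \<and> f x y}"

definition stable :: "(nat \<Rightarrow> nat \<Rightarrow> bool) \<Rightarrow> bool" where
  "stable f \<longleftrightarrow> (\<forall>x. \<exists>c N. \<forall>u. N < u \<and> x < u \<longrightarrow> f x u = c)"

definition homogeneous :: "(nat \<Rightarrow> nat \<Rightarrow> bool) \<Rightarrow> nat set \<Rightarrow> bool" where
  "homogeneous f H \<longleftrightarrow> infinite H \<and> (\<exists>c. \<forall>x\<in>H. \<forall>y\<in>H. x < y \<longrightarrow> f x y = c)"

definition p_homogeneous :: "(nat \<Rightarrow> nat \<Rightarrow> bool) \<Rightarrow> nat set \<Rightarrow> bool" where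
  "p_homogeneous g H \<longleftrightarrow> (\<exists>L R. infinite L \<and> infinite R \<and> H = L \<oplus> R \<and>
      (\<exists>c. \<forall>x\<in>L. \<forall>y\<in>R. x \<noteq> y \<longrightarrow> g (min x y) (max x y) = c))"

end

theory Submission
  imports Defs "HOL-Library.Countable_Set"
begin

text \<open>
  The family \<open>Y = {}\<close> works: \<open>f\<close> is a sufficiently generic stable coloring, and every stable \<open>f'\<close> computable from \<open>f\<close> has a
  p-homogeneous set which computes no set homogeneous for \<open>f\<close>. The p-homogeneous set consists of the elements of even and
  of odd rank of some \<open>Z\<close> whose members have the same limit color \<open>c\<close> under \<open>f'\<close> and for which \<open>f' x z = c\<close> whenever the
  ranks of \<open>x < z\<close> in \<open>Z\<close> have different parity. \<open>Z\<close> is built by finite end-extension inside an infinite set \<open>X\<close> that is chosen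
  before \<open>f\<close> and decides how the outputs of each functional grow along such extensions.

  If this fails for both colors, there are functionals whose outputs stay homogeneous for \<open>f\<close>. Extending by \<open>a\<close> produces,
  for either color, an output whose limit under \<open>f\<close> is still free, and this limit is forced if \<open>a\<close> has that color under
  \<open>f'\<close>. Hence controlling a single limit (a guard of \<open>a\<close>) keeps \<open>a\<close> away from one color. Now let \<open>y\<close> be an output caused by
  \<open>a0\<close>, and add guarded elements to \<open>a0\<close>. While the coming element has rank of the same parity as \<open>a0\<close>, it need not be
  compatible with \<open>a0\<close>, and the color of \<open>y\<close> can be switched; the next output \<open>y'\<close> on that side then satisfies
  \<open>f y y' \<noteq> lim f y\<close>, contrary to homogeneity.
\<close>

subsection \<open>Thinning along end-extensions\<close>

definition tail :: "nat set \<Rightarrow> nat filter" where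
  "tail X = inf at_top (principal X)"

lemma eventually_tail: "eventually Q (tail X) \<longleftrightarrow> (\<exists>m. \<forall>a\<in>X. m \<le> a \<longrightarrow> Q a)"
  unfolding tail_def eventually_inf_principal eventually_at_top_linorder by auto

lemma eventually_tail_mem: "\<forall>\<^sub>F a in tail X. a \<in> X"
  by (auto simp: eventually_tail)

lemma eventually_tail_ge: "\<forall>\<^sub>F a in tail X. n \<le> a"
  by (auto simp: eventually_tail)

lemma tail_neq_bot: "infinite X \<Longrightarrow> tail X \<noteq> bot"
  unfolding trivial_limit_def eventually_tail
  by (metis infinite_nat_iff_unbounded_le)

lemma tail_mono: "finite (X' - X) \<Longrightarrow> tail X' \<le> tail X"
proof (rule filter_leI)
  fix Q assume fin: "finite (X' - X)" and "eventually Q (tail X)"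
  then obtain m where m: "\<forall>a\<in>X. m \<le> a \<longrightarrow> Q a" by (auto simp: eventually_tail)
  from fin obtain k where "\<forall>a\<in>X' - X. a < k" by (auto simp: finite_nat_set_iff_bounded)
  with m have "\<forall>a\<in>X'. max m k \<le> a \<longrightarrow> Q a" by (meson DiffI leD max.boundedE)
  then show "eventually Q (tail X')" unfolding eventually_tail by blast
qed

lemma eventually_tail_finite_ball:
  assumes "finite S" "\<And>x. x \<in> S \<Longrightarrow> eventually (Q x) F"
  shows "\<forall>\<^sub>F a in F. \<forall>x\<in>S. Q x a"
  using assms by (simp add: eventually_ball_finite)

lemma frequently_tail_subset:
  assumes "\<exists>\<^sub>F a in tail X. Q a"
  shows "infinite {a\<in>X. Q a}"
  using assms by (auto simp: frequently_def eventually_tail infinite_nat_iff_unbounded_le)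

text \<open>The inductive definition of \<open>jbar\<close> recurs under \<open>eventually\<close>;
  as a \<open>mono\<close> rule this makes it acceptable.\<close>

lemma eventually_mono_rule [mono]:
  "(\<And>x. P x \<longrightarrow> Q x) \<Longrightarrow> eventually P F \<longrightarrow> eventually Q F"
  by (auto elim: eventually_mono)

text \<open>Adding elements of \<open>X\<close> to \<open>E\<close> one at a time, each large enough for the stage before it, cannot avoid an edge in \<open>B\<close>
  forever. Shrinking \<open>X\<close> preserves this, so thinning can decide it for countably
  many \<open>B\<close>; this replaces the open Ramsey theorem.\<close>

inductive jbar :: "nat set \<Rightarrow> (nat set \<Rightarrow> nat \<Rightarrow> bool) \<Rightarrow> nat set \<Rightarrow> bool" for X B where
  jbarI: "\<forall>\<^sub>F a in tail X. B E a \<or> jbar X B (insert a E) \<Longrightarrow> jbar X B E"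

lemma jbar_iff: "jbar X B E \<longleftrightarrow> (\<forall>\<^sub>F a in tail X. B E a \<or> jbar X B (insert a E))"
  by (subst jbar.simps) blast

lemma jbar_antimono:
  assumes "jbar X B E" "tail X' \<le> tail X"
  shows "jbar X' B E"
  using assms(1)
proof induction
  case (jbarI E)
  then have "\<forall>\<^sub>F a in tail X. B E a \<or> jbar X' B (insert a E)"
    by (auto elim: eventually_mono)
  then have "\<forall>\<^sub>F a in tail X'. B E a \<or> jbar X' B (insert a E)"
    using assms(2) by (rule filter_leD[rotated])
  then show ?case by (rule jbar.jbarI)
qed

text \<open>For each \<open>n\<close> in turn pass to an infinite subset with \<open>T n\<close> if
  one exists, then diagonalize. The diagonal set is almost contained in every set of the sequence,
  and \<open>T n\<close> is inherited by almost-subsets.\<close>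

lemma thinning:
  fixes T :: "nat \<Rightarrow> nat set \<Rightarrow> bool"
  assumes persist: "\<forall>n X X'. T n X \<longrightarrow> finite (X' - X) \<longrightarrow> T n X'"
    and inf: "infinite X0"
  shows "\<exists>X. X \<subseteq> X0 \<and> infinite X \<and> (\<forall>n. T n X \<or> (\<forall>X'\<subseteq>X. infinite X' \<longrightarrow> \<not> T n X'))"
proof -
  define nxt where "nxt n Y = (if \<exists>Y'\<subseteq>Y. infinite Y' \<and> T n Y' then SOME Y'. Y' \<subseteq> Y \<and> infinite Y' \<and> T n Y' else Y)" for n Y
  have nxt: "nxt n Y \<subseteq> Y \<and> infinite (nxt n Y) \<and> (T n (nxt n Y) \<or> (\<forall>Y'\<subseteq>Y. infinite Y' \<longrightarrow> \<not> T n Y'))"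
    if "infinite Y" for n Y
  proof (cases "\<exists>Y'\<subseteq>Y. infinite Y' \<and> T n Y'")
    case True
    then show ?thesis unfolding nxt_def using someI_ex[of "\<lambda>Y'. Y' \<subseteq> Y \<and> infinite Y' \<and> T n Y'"] by auto
  next
    case False
    then show ?thesis unfolding nxt_def using that by auto
  qed
  define Y where "Y = rec_nat X0 nxt"
  have Y0: "Y 0 = X0" and YS: "Y (Suc n) = nxt n (Y n)" for n by (auto simp: Y_def)
  have Yinf: "infinite (Y n)" for n by (induction n) (use inf nxt Y0 YS in auto)
  have Ydec: "Y n \<subseteq> Y m" if "m \<le> n" for m n
    using that by (rule lift_Suc_antimono_le[rotated]) (use nxt Yinf YS in auto)
  have "\<exists>x. x \<in> Y n \<and> k < x" for n k
    using Yinf[of n] by (meson infinite_nat_iff_unbounded)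
  then obtain pick where pick: "pick n k \<in> Y n" "k < pick n k" for n k by metis
  define x where "x = rec_nat (pick 0 0) (\<lambda>n xn. pick (Suc n) xn)"
  have xS: "x (Suc n) = pick (Suc n) (x n)" for n by (auto simp: x_def)
  have xY: "x n \<in> Y n" for n by (cases n) (auto simp: x_def pick)
  have xmono: "strict_mono x" by (simp add: strict_mono_Suc_iff xS pick)
  define X where "X = range x"
  have Xinf: "infinite X" unfolding X_def using xmono by (simp add: range_inj_infinite strict_mono_imp_inj_on)
  \<comment> \<open>Only the points picked before stage \<open>n\<close> can lie outside
    \<open>Y n\<close>.\<close>
  have XY: "finite (X - Y n)" for n
  proof -
    have "X - Y n \<subseteq> x ` {..<n}" unfolding X_def
      proof
      fix z assume "z \<in> range x - Y n"
      then obtain k where "z = x k" "x k \<notin> Y n" by blast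
      then show "z \<in> x ` {..<n}" using xY[of k] Ydec[of n k] by (cases "k < n") auto
    qed
    then show ?thesis by (meson finite_imageI finite_lessThan finite_subset)
  qed
  have "X \<subseteq> X0" using xY Ydec[of 0] Y0 unfolding X_def by blast
  moreover have "T n X \<or> (\<forall>X'\<subseteq>X. infinite X' \<longrightarrow> \<not> T n X')" for n
  proof (cases "T n (Y (Suc n))")
    case True
    then show ?thesis using persist XY by blast
  next
    case False
    then have no: "\<forall>Y'\<subseteq>Y n. infinite Y' \<longrightarrow> \<not> T n Y'" using nxt[OF Yinf, of n] YS by auto
    \<comment> \<open>Cutting \<open>X'\<close> down to \<open>Y n\<close> removes finitely many
      points and keeps \<open>T n\<close>, so \<open>Y n\<close> would have an infinite subset with
      \<open>T n\<close> after all.\<close>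
    have "\<not> T n X'" if "X' \<subseteq> X" "infinite X'" for X'
    proof
      assume "T n X'"
      have "finite (X' - Y n)" using XY[of n] that by (meson Diff_mono finite_subset order_refl)
      then have "infinite (X' \<inter> Y n)" using that by (metis Int_Diff_Un finite_Un)
      moreover have "T n (X' \<inter> Y n)" using persist[rule_format, OF \<open>T n X'\<close>, of "X' \<inter> Y n"]
        by (simp add: Diff_eq_empty_iff[THEN iffD2])
      ultimately show False using no by blast
    qed
    then show ?thesis by blast
  qed
  ultimately show ?thesis using Xinf by blast
qed

text \<open>If the second alternative fails, restricting \<open>X\<close> to the infinitely many
  offending \<open>a\<close> makes \<open>E\<close> barred there; an infinite subset then has the
  property, so \<open>thinning\<close> gives it to \<open>X\<close> itself. Coding finite
  \<open>E\<close> by numbers keeps the list of properties countable.\<close>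

lemma thin_jbar:
  fixes B :: "nat \<Rightarrow> nat set \<Rightarrow> nat \<Rightarrow> bool"
  assumes "infinite X0"
  shows "\<exists>X. X \<subseteq> X0 \<and> infinite X \<and> (\<forall>n E. finite E \<longrightarrow>
    jbar X (B n) E \<or> (\<forall>\<^sub>F a in tail X. \<not> B n E a \<and> \<not> jbar X (B n) (insert a E)))"
proof -
  define T where "T m X = jbar X (B (fst (prod_decode m))) (set_decode (snd (prod_decode m)))" for m X
  have T_mono: "\<forall>m X X'. T m X \<longrightarrow> finite (X' - X) \<longrightarrow> T m X'"
    unfolding T_def using jbar_antimono[OF _ tail_mono] by blast
  obtain X where X: "X \<subseteq> X0" "infinite X" and dec: "\<forall>n. T n X \<or> (\<forall>X'\<subseteq>X. infinite X' \<longrightarrow> \<not> T n X')"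
    using thinning[OF T_mono assms] by (elim exE conjE)
  have "jbar X (B n) E \<or> (\<forall>\<^sub>F a in tail X. \<not> B n E a \<and> \<not> jbar X (B n) (insert a E))" if "finite E" for n E
  proof (rule ccontr)
    assume neg: "\<not> ?thesis"
    let ?m = "prod_encode (n, set_encode E)"
    have T: "T ?m X' = jbar X' (B n) E" for X' unfolding T_def using that by simp
    have "\<exists>\<^sub>F a in tail X. B n E a \<or> jbar X (B n) (insert a E)"
      using neg by (auto simp: frequently_def)
    from frequently_tail_subset[OF this]
    have inf: "infinite {a\<in>X. B n E a \<or> jbar X (B n) (insert a E)}" (is "infinite ?X'") .
    have "tail ?X' \<le> tail X"
      by (rule tail_mono) (rule finite_subset[of _ "{}"], auto)
    then have "jbar ?X' (B n) E"
      using eventually_tail_mem[of ?X'] by (intro jbarI) (auto elim!: eventually_mono dest: jbar_antimono)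
    then have "T ?m ?X'" using T by simp
    then have "T ?m X" using dec[rule_format, of ?m] inf by (metis (no_types, lifting) mem_Collect_eq subsetI)
    then show False using neg T by simp
  qed
  then show ?thesis using X by (intro exI[of _ X]) simp
qed

text \<open>Cohesiveness: the same argument, with the property that almost all of the set satisfies
  \<open>R n E\<close>.\<close>

lemma thin_cohesive:
  fixes R :: "nat \<Rightarrow> nat set \<Rightarrow> nat \<Rightarrow> bool"
  assumes "infinite X0"
  shows "\<exists>X. X \<subseteq> X0 \<and> infinite X \<and> (\<forall>n E. finite E \<longrightarrow>
    (\<forall>\<^sub>F a in tail X. R n E a) \<or> (\<forall>\<^sub>F a in tail X. \<not> R n E a))"
proof -
  define T where "T m X = (\<forall>\<^sub>F a in tail X. R (fst (prod_decode m)) (set_decode (snd (prod_decode m))) a)" for m X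
  have T_mono: "\<forall>m X X'. T m X \<longrightarrow> finite (X' - X) \<longrightarrow> T m X'"
    unfolding T_def using filter_leD[OF tail_mono] by blast
  obtain X where X: "X \<subseteq> X0" "infinite X" and dec: "\<forall>n. T n X \<or> (\<forall>X'\<subseteq>X. infinite X' \<longrightarrow> \<not> T n X')"
    using thinning[OF T_mono assms] by (elim exE conjE)
  have "(\<forall>\<^sub>F a in tail X. R n E a) \<or> (\<forall>\<^sub>F a in tail X. \<not> R n E a)" if "finite E" for n E
  proof (rule ccontr)
    assume neg: "\<not> ?thesis"
    let ?m = "prod_encode (n, set_encode E)"
    have T: "T ?m X' = (\<forall>\<^sub>F a in tail X'. R n E a)" for X' unfolding T_def using that by simp
    have "\<exists>\<^sub>F a in tail X. R n E a" using neg by (auto simp: frequently_def)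
    from frequently_tail_subset[OF this] have inf: "infinite {a\<in>X. R n E a}" (is "infinite ?X'") .
    have "T ?m ?X'" unfolding T using eventually_tail_mem[of ?X'] by (auto elim!: eventually_mono)
    then have "T ?m X" using dec[rule_format, of ?m] inf by (metis (no_types, lifting) mem_Collect_eq subsetI)
    then show False using neg T by simp
  qed
  then show ?thesis using X by (intro exI[of _ X]) simp
qed

subsection \<open>Conditions\<close>

type_synonym coloring = "nat \<Rightarrow> nat \<Rightarrow> bool"

definition agree :: "nat \<Rightarrow> coloring \<Rightarrow> coloring \<Rightarrow> bool" where
  "agree k f g \<longleftrightarrow> (\<forall>x z. x < z \<and> z < k \<longrightarrow> f x z = g x z)"

definition has_lim :: "coloring \<Rightarrow> nat \<Rightarrow> bool \<Rightarrow> bool" where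
  "has_lim g a c \<longleftrightarrow> (\<forall>\<^sub>F u in at_top. g a u = c)"

definition end_ext :: "nat set \<Rightarrow> nat set \<Rightarrow> bool" where
  "end_ext E Z \<longleftrightarrow> E \<subseteq> Z \<and> (\<forall>z\<in>Z - E. \<forall>e\<in>E. e < z)"

lemma stable_has_lim: "stable g \<longleftrightarrow> (\<forall>a. \<exists>c. has_lim g a c)"
proof
  assume "stable g"
  show "\<forall>a. \<exists>c. has_lim g a c"
  proof
    fix a
    obtain c N where "\<forall>u. N < u \<and> a < u \<longrightarrow> g a u = c" using \<open>stable g\<close> unfolding stable_def by blast
    then have "has_lim g a c" unfolding has_lim_def eventually_at_top_linorder by (meson Suc_le_lessD le_less_trans max.cobounded1 max.cobounded2 max_less_iff_conj)
    then show "\<exists>c. has_lim g a c" by blast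
  qed
next
  assume "\<forall>a. \<exists>c. has_lim g a c"
  then show "stable g" unfolding stable_def has_lim_def eventually_at_top_linorder by (meson less_imp_le)
qed

text \<open>All that is used of oracle computation. \<open>Phi i f a u c\<close> reads: functional
  \<open>i\<close> with oracle \<open>f\<close> gives the pair of \<open>a\<close> and
  \<open>u\<close> the color \<open>c\<close>. \<open>Psi j Z y\<close> reads: functional
  \<open>j\<close> accepts \<open>y\<close> from the p-homogeneous set coded by
  \<open>Z\<close>.\<close>

locale functionals =
  fixes Phi :: "nat \<Rightarrow> coloring \<Rightarrow> nat \<Rightarrow> nat \<Rightarrow> bool \<Rightarrow> bool"
    and Psi :: "nat \<Rightarrow> nat set \<Rightarrow> nat \<Rightarrow> bool"
  assumes Phi_use: "Phi i f a u c \<Longrightarrow> \<exists>k. \<forall>g. agree k f g \<longrightarrow> Phi i g a u c"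
    and Phi_fun: "Phi i f a u c \<Longrightarrow> Phi i f a u c' \<Longrightarrow> c = c'"
    and Psi_use: "Psi j Z y \<Longrightarrow> \<exists>k. \<forall>Z'. Z' \<inter> {..<k} = Z \<inter> {..<k} \<longrightarrow> Psi j Z' y"
begin

definition settled :: "nat \<Rightarrow> nat set \<Rightarrow> nat \<Rightarrow> bool" where
  "settled j E y \<longleftrightarrow> (\<forall>Z. end_ext E Z \<longrightarrow> Psi j Z y)"

text \<open>A number counts as an output as soon as it has become unavoidable. Otherwise a functional could delay announcing it
  until its limit color is already fixed.\<close>

definition prom :: "nat set \<Rightarrow> nat \<Rightarrow> nat set \<Rightarrow> nat \<Rightarrow> bool" where
  "prom Y j E y \<longleftrightarrow> settled j E y \<or> jbar Y (\<lambda>E a. settled j (insert a E) y) E"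

definition fresh :: "nat set \<Rightarrow> nat \<Rightarrow> nat set \<Rightarrow> nat \<Rightarrow> bool" where
  "fresh Y j E a \<longleftrightarrow> (\<exists>y. prom Y j (insert a E) y \<and> \<not> prom Y j E y)"

lemma settled_insert: "settled j E y \<Longrightarrow> \<forall>e\<in>E. e < a \<Longrightarrow> settled j (insert a E) y"
  unfolding settled_def end_ext_def by (metis Diff_iff insert_iff insert_subset)

end

text \<open>\<open>Y\<close> decides which outputs are promised. What counts as a new output depends
  on \<open>Y\<close>, so a second thinning to \<open>X\<close> is made to decide where new outputs
  appear.\<close>

locale thinned = functionals +
  fixes Y X :: "nat set"
  assumes X_sub: "X \<subseteq> Y" and X_inf: "infinite X"
    and dec1: "finite E \<Longrightarrow> jbar Y (\<lambda>E a. settled j (insert a E) y) E \<or>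
      (\<forall>\<^sub>F a in tail Y. \<not> settled j (insert a E) y \<and> \<not> jbar Y (\<lambda>E a. settled j (insert a E) y) (insert a E))"
    and dec2: "finite E \<Longrightarrow> jbar X (\<lambda>E a. fresh Y j E a \<and> even (card E) = p) E \<or>
      (\<forall>\<^sub>F a in tail X. \<not> (fresh Y j E a \<and> even (card E) = p) \<and> \<not> jbar X (\<lambda>E a. fresh Y j E a \<and> even (card E) = p) (insert a E))"
    and dec3: "finite E \<Longrightarrow> (\<forall>\<^sub>F a in tail X. fresh Y j E a) \<or> (\<forall>\<^sub>F a in tail X. \<not> fresh Y j E a)"
begin

abbreviation P where "P \<equiv> prom Y"
abbreviation new where "new \<equiv> fresh Y"
text \<open>\<open>p\<close> is the parity of the stage, which is also the parity of the rank of the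
  coming element; \<open>True\<close> stands for even.\<close>

abbreviation soon where "soon j p \<equiv> jbar X (\<lambda>E a. new j E a \<and> even (card E) = p)"

lemma tail_le: "tail X \<le> tail Y"
  using X_sub by (intro tail_mono) (simp add: Diff_eq_empty_iff[THEN iffD2])

lemma eventually_X: "eventually Q (tail Y) \<Longrightarrow> eventually Q (tail X)"
  using tail_le by (rule filter_leD)

lemma eventually_gt: "finite E \<Longrightarrow> \<forall>\<^sub>F a in tail X. \<forall>e\<in>E. e < a"
  by (rule eventually_tail_finite_ball) (use eventually_tail_ge[of "Suc _" X] in \<open>auto simp: Suc_le_eq\<close>)

section \<open>Promised outputs when one element is added\<close>

lemma P_keep:
  assumes "finite E" "P j E y"
  shows "\<forall>\<^sub>F a in tail X. P j (insert a E) y"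
proof (cases "settled j E y")
  case True
  then show ?thesis using eventually_gt[OF assms(1)] by (auto elim!: eventually_mono simp: prom_def settled_insert)
next
  case False
  then have "jbar Y (\<lambda>E a. settled j (insert a E) y) E" using assms by (simp add: prom_def)
  then have "\<forall>\<^sub>F a in tail Y. settled j (insert a E) y \<or> jbar Y (\<lambda>E a. settled j (insert a E) y) (insert a E)"
    by (subst (asm) jbar_iff)
  then show ?thesis unfolding prom_def by (rule eventually_X)
qed

text \<open>The second alternative of \<open>dec1\<close> says that an unpromised output stays
  unpromised. Together with \<open>P_keep\<close>, each single output changes its status at
  \<open>E\<close> for only finitely many \<open>a\<close> in \<open>X\<close>.\<close>

lemma P_avoid:
  assumes "finite E" "\<not> P j E y"
  shows "\<forall>\<^sub>F a in tail X. \<not> P j (insert a E) y"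
  using dec1[OF assms(1), of j y] assms(2) eventually_X by (auto simp: prom_def)

text \<open>None of the finitely many numbers below \<open>n\<close> becomes promised, by
  \<open>P_avoid\<close>, so a new output must be at least \<open>n\<close>.\<close>

lemma new_large:
  assumes "finite E"
  shows "\<forall>\<^sub>F a in tail X. new j E a \<longrightarrow> (\<exists>y\<ge>n. P j (insert a E) y \<and> \<not> P j E y)"
proof -
  have "\<forall>\<^sub>F a in tail X. \<forall>y\<in>{..<n}. \<not> P j E y \<longrightarrow> \<not> P j (insert a E) y"
    by (rule eventually_tail_finite_ball) (use P_avoid[OF assms] in \<open>auto intro: always_eventually\<close>)
  then show ?thesis by (rule eventually_mono) (metis fresh_def lessThan_iff not_le)
qed

definition quiet :: "nat \<Rightarrow> nat set \<Rightarrow> bool" where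
  "quiet j E \<longleftrightarrow> (\<forall>p. \<not> soon j p E)"

lemma quiet_iff: "quiet j E \<longleftrightarrow> \<not> soon j p E \<and> \<not> soon j (\<not> p) E"
proof -
  have "(\<forall>p. \<not> Q p) \<longleftrightarrow> \<not> Q p \<and> \<not> Q (\<not> p)" for Q :: "bool \<Rightarrow> bool"
    by (cases p) (auto simp: all_bool_eq)
  from this[of "\<lambda>p. soon j p E"] show ?thesis unfolding quiet_def .
qed

lemma soon_avoid:
  assumes "finite E" "\<not> soon j p E"
  shows "\<forall>\<^sub>F a in tail X. \<not> soon j p (insert a E)"
    and "\<forall>\<^sub>F a in tail X. \<not> (new j E a \<and> even (card E) = p)"
proof -
  have *: "\<forall>\<^sub>F a in tail X. \<not> (new j E a \<and> even (card E) = p) \<and> \<not> soon j p (insert a E)"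
    using dec2[OF assms(1), of j p] assms(2) by blast
  from * show "\<forall>\<^sub>F a in tail X. \<not> soon j p (insert a E)" by (rule eventually_mono) blast
  from * show "\<forall>\<^sub>F a in tail X. \<not> (new j E a \<and> even (card E) = p)" by (rule eventually_mono) blast
qed

lemma quiet_step:
  assumes "finite E" "quiet j E"
  shows "\<forall>\<^sub>F a in tail X. \<not> new j E a \<and> quiet j (insert a E)"
proof -
  have *: "\<forall>\<^sub>F a in tail X. \<not> soon j p (insert a E) \<and> \<not> (new j E a \<and> even (card E) = p)" for p
    using soon_avoid[OF assms(1), of j p] assms(2) by (auto simp: quiet_def eventually_conj_iff)
  have "\<forall>\<^sub>F a in tail X. \<forall>p\<in>UNIV. \<not> soon j p (insert a E) \<and> \<not> (new j E a \<and> even (card E) = p)"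
    by (rule eventually_tail_finite_ball) (use * in auto)
  then show ?thesis by (rule eventually_mono) (auto simp: quiet_def)
qed

text \<open>The bound \<open>j < card E\<close> leaves finitely many constraints, so almost every
  \<open>a\<close> meets them; still each \<open>j\<close> is covered from some stage on, and if
  quiet then, it stays quiet and gains no output.\<close>

definition ok :: "nat set \<Rightarrow> nat \<Rightarrow> bool" where
  "ok E a \<longleftrightarrow> a \<in> X \<and> (\<forall>e\<in>E. e < a) \<and>
    (\<forall>j<card E. quiet j E \<longrightarrow> \<not> new j E a \<and> quiet j (insert a E))"

lemma eventually_ok:
  assumes "finite E"
  shows "\<forall>\<^sub>F a in tail X. ok E a"
proof -
  have "\<forall>\<^sub>F a in tail X. \<forall>j\<in>{..<card E}. quiet j E \<longrightarrow> \<not> new j E a \<and> quiet j (insert a E)"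
    by (rule eventually_tail_finite_ball) (use quiet_step[OF assms] in \<open>auto intro: always_eventually\<close>)
  then show ?thesis using eventually_gt[OF assms] eventually_tail_mem[of X]
    unfolding ok_def by eventually_elim auto
qed

text \<open>\<open>card D\<close> is the rank of \<open>a\<close> in \<open>insert a D\<close>, so
  compatibility is demanded only with elements whose rank has the other parity.\<close>

definition step :: "bool \<Rightarrow> coloring \<Rightarrow> nat set \<Rightarrow> nat set \<Rightarrow> bool" where
  "step c g D D' \<longleftrightarrow> (\<exists>a. D' = insert a D \<and> ok D a \<and> has_lim g a c \<and>
     (\<forall>x\<in>D. odd (card (D \<inter> {..<x}) + card D) \<longrightarrow> g x a = c))"

abbreviation steps where "steps c g \<equiv> (step c g)\<^sup>*\<^sup>*"

definition cnd :: "bool \<Rightarrow> coloring \<Rightarrow> nat set \<Rightarrow> bool" where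
  "cnd c g E \<longleftrightarrow> finite E \<and> (\<forall>x\<in>E. has_lim g x c)"

lemma cnd_empty: "cnd c g {}" by (simp add: cnd_def)

lemma step_cnd: "step c g D D' \<Longrightarrow> cnd c g D \<Longrightarrow> cnd c g D'"
  by (auto simp: step_def cnd_def)

lemma steps_cnd: "steps c g D D' \<Longrightarrow> cnd c g D \<Longrightarrow> cnd c g D'"
  by (induction rule: rtranclp_induct) (auto intro: step_cnd)

lemma step_settled: "step c g D D' \<Longrightarrow> settled j D y \<Longrightarrow> settled j D' y"
  by (auto simp: step_def ok_def intro: settled_insert)

lemma steps_settled: "steps c g D D' \<Longrightarrow> settled j D y \<Longrightarrow> settled j D' y"
  by (induction rule: rtranclp_induct) (auto intro: step_settled)

lemma settled_P: "settled j D y \<Longrightarrow> P j D y"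
  by (simp add: prom_def)

section \<open>Realizing unavoidable events by admissible steps\<close>

lemma eventually_step:
  assumes "cnd c g D"
  shows "\<forall>\<^sub>F a in tail X. has_lim g a c \<longrightarrow> step c g D (insert a D)"
proof -
  have "\<forall>\<^sub>F a in tail X. g x a = c" if "x \<in> D" for x
  proof -
    have "has_lim g x c" using assms that by (simp add: cnd_def)
    then show ?thesis unfolding has_lim_def tail_def
      by (simp add: eventually_inf_principal) (auto elim: eventually_mono)
  qed
  then have "\<forall>\<^sub>F a in tail X. \<forall>x\<in>D. g x a = c"
    using assms by (intro eventually_tail_finite_ball) (auto simp: cnd_def)
  moreover have "\<forall>\<^sub>F a in tail X. ok D a" using assms by (intro eventually_ok) (simp add: cnd_def)
  ultimately show ?thesis by eventually_elim (auto simp: step_def)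
qed

lemma extend1:
  assumes "cnd c g D" "\<exists>\<^sub>F a in tail X. has_lim g a c" "eventually Q (tail X)"
  shows "\<exists>a. Q a \<and> step c g D (insert a D)"
proof -
  have "\<exists>\<^sub>F a in tail X. has_lim g a c \<and> (Q a \<and> (has_lim g a c \<longrightarrow> step c g D (insert a D)))"
    using frequently_eventually_frequently[OF assms(2) eventually_conj[OF assms(3) eventually_step[OF assms(1)]]] .
  then show ?thesis by (auto dest: frequently_ex)
qed

text \<open>A bar is reached by admissible steps too: at each stage almost every \<open>a\<close> in
  \<open>X\<close> is as the bar wants, and infinitely many of these have limit \<open>c\<close>.
  \<open>K\<close> is an invariant carried along; \<open>Ev\<close> is a further demand on the last
  step.\<close>

lemma walk:
  assumes "jbar Y' B E" and le: "tail X \<le> tail Y'" and "cnd c g E"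
    and freq: "\<exists>\<^sub>F a in tail X. has_lim g a c"
    and Ev: "\<And>D. cnd c g D \<Longrightarrow> \<forall>\<^sub>F a in tail X. Ev D a"
    and K: "\<And>D. cnd c g D \<Longrightarrow> K D \<Longrightarrow> \<forall>\<^sub>F a in tail X. K (insert a D)"
    and "K E"
  shows "\<exists>D a. steps c g E D \<and> cnd c g D \<and> K D \<and> step c g D (insert a D) \<and> B D a \<and> Ev D a \<and> K (insert a D)"
  using assms(1,3,7)
proof (induction)
  case (jbarI E)
  have "\<forall>\<^sub>F a in tail X. (B E a \<or> (jbar Y' B (insert a E) \<and> (cnd c g (insert a E) \<longrightarrow> K (insert a E) \<longrightarrow>
      (\<exists>D b. steps c g (insert a E) D \<and> cnd c g D \<and> K D \<and> step c g D (insert b D) \<and> B D b \<and> Ev D b \<and> K (insert b D)))))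
      \<and> Ev E a \<and> K (insert a E)"
    using filter_leD[OF le jbarI.IH] Ev[OF jbarI.prems(1)] K[OF jbarI.prems] by eventually_elim auto
  from extend1[OF jbarI.prems(1) freq this] obtain a where
    a: "step c g E (insert a E)" "Ev E a" "K (insert a E)" and
    alt: "B E a \<or> (cnd c g (insert a E) \<longrightarrow> K (insert a E) \<longrightarrow>
      (\<exists>D b. steps c g (insert a E) D \<and> cnd c g D \<and> K D \<and> step c g D (insert b D) \<and> B D b \<and> Ev D b \<and> K (insert b D)))"
    by blast
  show ?case
  proof (cases "B E a")
    case True
    then show ?thesis using a jbarI.prems by blast
  next
    case False
    then obtain D b where "steps c g (insert a E) D" "cnd c g D \<and> K D \<and> step c g D (insert b D) \<and> B D b \<and> Ev D b \<and> K (insert b D)"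
      using alt a step_cnd[OF a(1) jbarI.prems(1)] by blast
    then show ?thesis using a(1) by (meson converse_rtranclp_into_rtranclp)
  qed
qed

text \<open>\<open>S\<close> holds promises still to be fulfilled; \<open>P_keep\<close> lets them
  survive the walk.\<close>

lemma fulfill1:
  assumes "cnd c g E" "\<exists>\<^sub>F a in tail X. has_lim g a c" "P j E y"
    and "finite S" "\<forall>z\<in>S. P j E z"
  shows "\<exists>D. steps c g E D \<and> settled j D y \<and> (\<forall>z\<in>S. P j D z)"
proof (cases "settled j E y")
  case True
  then show ?thesis using assms by blast
next
  case False
  then have J: "jbar Y (\<lambda>E a. settled j (insert a E) y) E" using assms(3) by (simp add: prom_def)
  have K: "\<forall>\<^sub>F a in tail X. \<forall>z\<in>S. P j (insert a D) z" if "cnd c g D" "\<forall>z\<in>S. P j D z" for D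
    using that P_keep by (intro eventually_tail_finite_ball[OF assms(4)]) (auto simp: cnd_def)
  from walk[OF J tail_le assms(1,2), of "\<lambda>_ _. True" "\<lambda>D. \<forall>z\<in>S. P j D z"] K assms(5)
  obtain D a where "steps c g E D" "step c g D (insert a D)" "settled j (insert a D) y" "\<forall>z\<in>S. P j (insert a D) z"
    by auto
  then show ?thesis by (meson rtranclp.rtrancl_into_rtrancl)
qed

lemma fulfill:
  assumes "finite S" "cnd c g E" "\<exists>\<^sub>F a in tail X. has_lim g a c" "\<forall>z\<in>S. P j E z"
  shows "\<exists>D. steps c g E D \<and> (\<forall>z\<in>S. settled j D z)"
proof -
  have "\<exists>D. steps c g E D \<and> (\<forall>z\<in>T. settled j D z) \<and> (\<forall>z\<in>S. P j D z)" if "finite T" "T \<subseteq> S" for T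
    using that
  proof (induction T)
    case empty
    then show ?case using assms by auto
  next
    case (insert y T)
    then obtain D where D: "steps c g E D" "\<forall>z\<in>T. settled j D z" "\<forall>z\<in>S. P j D z" by auto
    have "P j D y" using D insert.prems by auto
    from fulfill1[OF steps_cnd[OF D(1) assms(2)] assms(3) this assms(1) D(3)]
    obtain D' where D': "steps c g D D'" "settled j D' y" "\<forall>z\<in>S. P j D' z" by blast
    moreover have "\<forall>z\<in>T. settled j D' z" using D(2) steps_settled[OF D'(1)] by blast
    ultimately show ?case using D(1) by (intro exI[of _ D']) (auto intro: rtranclp_trans)
  qed
  from this[OF assms(1)] show ?thesis by auto
qed

text \<open>By \<open>dec3\<close>, either almost all or almost no \<open>a\<close> cause a new
  output at \<open>D\<close>. Excluding, in the second case, the few exceptions along the walk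
  ensures that the \<open>D\<close> where it ends is of the first kind.\<close>

lemma outputs_exist:
  assumes "soon j p E" "cnd c g E" and freq: "\<exists>\<^sub>F a in tail X. has_lim g a c"
    and K: "\<And>D. cnd c g D \<Longrightarrow> K D \<Longrightarrow> \<forall>\<^sub>F a in tail X. K (insert a D)" and "K E"
  shows "\<exists>D. steps c g E D \<and> cnd c g D \<and> K D \<and> even (card D) = p \<and> (\<forall>\<^sub>F a in tail X. new j D a)"
proof -
  have Ev: "\<forall>\<^sub>F a in tail X. new j D a \<longrightarrow> (\<forall>\<^sub>F b in tail X. new j D b)" if "cnd c g D" for D
    using dec3[of D j]
  proof
    show "finite D" using that by (simp add: cnd_def)
  next
    assume "\<forall>\<^sub>F a in tail X. new j D a"
    then show ?thesis by (simp add: always_eventually)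
  next
    assume "\<forall>\<^sub>F a in tail X. \<not> new j D a"
    then show ?thesis by (rule eventually_mono) blast
  qed
  have "\<exists>D a. steps c g E D \<and> cnd c g D \<and> K D \<and> step c g D (insert a D) \<and> (new j D a \<and> even (card D) = p) \<and>
      (new j D a \<longrightarrow> (\<forall>\<^sub>F b in tail X. new j D b)) \<and> K (insert a D)"
    by (rule walk[OF assms(1) order_refl assms(2) freq Ev K \<open>K E\<close>])
  then show ?thesis by blast
qed

text \<open>The stage can produce an output, and infinitely often a second one of the same parity is
  unavoidable afterwards.\<close>

definition crit :: "nat \<Rightarrow> bool \<Rightarrow> nat set \<Rightarrow> bool" where
  "crit j p E \<longleftrightarrow> even (card E) = p \<and> (\<forall>\<^sub>F a in tail X. new j E a) \<and> (\<exists>\<^sub>F a in tail X. soon j p (insert a E))"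

text \<open>Outputs may be produced on one side of the alternation only; two successive ones on the same side are what the
  contradiction needs.\<close>

lemma crit_exists:
  assumes E: "cnd c g E" and freq: "\<exists>\<^sub>F a in tail X. has_lim g a c"
    and noisy: "\<forall>D. steps c g E D \<longrightarrow> \<not> quiet j D"
  shows "\<exists>D p. steps c g E D \<and> crit j p D"
proof (rule ccontr)
  assume no: "\<not> ?thesis"
  have "\<not> quiet j E" using noisy by simp
  then obtain p where p: "soon j p E" unfolding quiet_def by auto
  have "\<exists>D. steps c g E D \<and> cnd c g D \<and> True \<and> even (card D) = p \<and> (\<forall>\<^sub>F a in tail X. new j D a)"
    by (rule outputs_exist[OF p E freq]) auto
  then obtain D1 where
    D1: "steps c g E D1" "cnd c g D1" "even (card D1) = p" "\<forall>\<^sub>F a in tail X. new j D1 a" by auto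
  have "\<forall>\<^sub>F a in tail X. \<not> soon j p (insert a D1)"
  proof (rule ccontr)
    assume "\<not> ?thesis"
    then have "crit j p D1" using D1(3,4) by (simp only: crit_def frequently_def simp_thms)
    then show False using no D1(1) by blast
  qed
  from extend1[OF D1(2) freq this] obtain a where
    a: "\<not> soon j p (insert a D1)" "step c g D1 (insert a D1)" by blast
  have st: "steps c g E (insert a D1)" using D1(1) a(2) by (rule rtranclp.rtrancl_into_rtrancl)
  then have "\<not> quiet j (insert a D1)" using noisy by blast
  \<comment> \<open>Parity \<open>p\<close> has been switched off, so the other one must be on. The
    argument is repeated for it with \<open>\<not> soon j p\<close> as the invariant.\<close>
  then have q: "soon j (\<not> p) (insert a D1)" using a(1) quiet_iff[of j _ p] by simp
  have "\<exists>D. steps c g (insert a D1) D \<and> cnd c g D \<and> \<not> soon j p D \<and> even (card D) = (\<not> p) \<and>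
      (\<forall>\<^sub>F a in tail X. new j D a)"
    by (rule outputs_exist[where K = "\<lambda>D. \<not> soon j p D", OF q step_cnd[OF a(2) D1(2)] freq _ a(1)])
      (rule soon_avoid(1), simp add: cnd_def, assumption)
  then obtain D2 where D2: "steps c g (insert a D1) D2" "cnd c g D2" "\<not> soon j p D2"
    "even (card D2) = (\<not> p)" "\<forall>\<^sub>F a in tail X. new j D2 a" by blast
  have st2: "steps c g E D2" using st D2(1) by (rule rtranclp_trans)
  have "\<forall>\<^sub>F a in tail X. \<not> soon j (\<not> p) (insert a D2)"
  proof (rule ccontr)
    assume "\<not> ?thesis"
    then have "crit j (\<not> p) D2" using D2(4,5) by (simp only: crit_def frequently_def simp_thms)
    then show False using no st2 by (simp only: not_ex) blast
  qed
  moreover have "\<forall>\<^sub>F a in tail X. \<not> soon j p (insert a D2)"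
    using soon_avoid(1)[OF _ D2(3)] D2(2) unfolding cnd_def by blast
  \<comment> \<open>Both parities are off after almost every further element, which makes
    \<open>j\<close> quiet.\<close>
  ultimately have "\<forall>\<^sub>F a in tail X. quiet j (insert a D2)"
    unfolding quiet_iff[of j _ p] by (rule eventually_conj[rotated])
  from extend1[OF D2(2) freq this] obtain b where
    b: "quiet j (insert b D2)" "step c g D2 (insert b D2)" by blast
  have "steps c g E (insert b D2)" using st2 b(2) by (rule rtranclp.rtrancl_into_rtrancl)
  then show False using noisy b(1) by simp
qed

text \<open>The shape of a failure of the construction for limit color \<open>c\<close>, caused by
  functional \<open>j\<close>. Colorings with a failure of fixed parameters will be shown nowhere
  dense in two situations that cover all cases.\<close>

definition bad :: "bool \<Rightarrow> coloring \<Rightarrow> coloring \<Rightarrow> nat \<Rightarrow> bool \<Rightarrow> bool \<Rightarrow> nat set \<Rightarrow> bool" where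
  "bad c f g j d p E \<longleftrightarrow> (\<exists>\<^sub>F a in tail X. has_lim g a c) \<and> steps c g {} E \<and> crit j p E \<and>
    (\<forall>D y z. steps c g E D \<and> P j D y \<and> P j D z \<and> y < z \<longrightarrow> f y z = d) \<and>
    (\<forall>D. steps c g E D \<longrightarrow> \<not> quiet j D)"

text \<open>Once \<open>y\<close> is settled it remains an output for good. As \<open>j\<close> is
  never quiet, a later critical stage yields an output \<open>z\<close> beyond the point where
  \<open>f y\<close> has reached its limit, and \<open>f y z = d\<close>.\<close>

lemma bad_lim:
  assumes bad: "bad c f g j d p E" and D: "steps c g E D" and y: "P j D y" and v: "has_lim f y v"
  shows "v = d"
proof -
  have freq: "\<exists>\<^sub>F a in tail X. has_lim g a c" and E: "cnd c g E"
    using bad steps_cnd[OF _ cnd_empty] unfolding bad_def by auto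
  obtain D1 where D1: "steps c g D D1" "settled j D1 y"
    using fulfill[of "{y}" c g D j] steps_cnd[OF D E] freq y by auto
  have ED1: "steps c g E D1" using D D1(1) by (rule rtranclp_trans)
  have "\<exists>D2 p. steps c g D1 D2 \<and> crit j p D2"
    using bad ED1 unfolding bad_def
    by (intro crit_exists[OF steps_cnd[OF ED1 E] freq]) (auto dest: rtranclp_trans)
  then obtain D2 where D2: "steps c g D1 D2" "\<forall>\<^sub>F a in tail X. new j D2 a" by (auto simp: crit_def)
  have ED2: "steps c g E D2" using ED1 D2(1) by (rule rtranclp_trans)
  then have cD2: "cnd c g D2" using E by (rule steps_cnd)
  obtain m where m: "\<And>u. m \<le> u \<Longrightarrow> f y u = v" using v unfolding has_lim_def eventually_at_top_linorder by blast
  have "\<forall>\<^sub>F a in tail X. \<exists>z\<ge>max m (Suc y). P j (insert a D2) z"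
    using new_large[of D2 j "max m (Suc y)"] D2(2) cD2 unfolding cnd_def by (auto elim: eventually_elim2)
  from extend1[OF cD2 freq this] obtain a z where
    a: "step c g D2 (insert a D2)" and z: "max m (Suc y) \<le> z" "P j (insert a D2) z" by blast
  have "steps c g E (insert a D2)" using ED2 a by (rule rtranclp.rtrancl_into_rtrancl)
  moreover have "P j (insert a D2) y"
    using step_settled[OF a] steps_settled[OF D2(1)] D1(2) settled_P by blast
  ultimately have "f y z = d" using bad z unfolding bad_def by (metis Suc_le_eq max.bounded_iff)
  then show ?thesis using m[of z] z by simp
qed

end

subsection \<open>Building alternating sets\<close>

text \<open>A witness of four numbers: it can be forced by a finite condition and survives in every
  superset.\<close>

definition inhom :: "coloring \<Rightarrow> nat set \<Rightarrow> bool" where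
  "inhom f S \<longleftrightarrow> (\<exists>y\<in>S. \<exists>y'\<in>S. \<exists>z\<in>S. \<exists>z'\<in>S. y < y' \<and> z < z' \<and> f y y' \<noteq> f z z')"

lemma inhom_not_homogeneous: "inhom f S \<Longrightarrow> S \<subseteq> H \<Longrightarrow> \<not> homogeneous f H"
  unfolding inhom_def homogeneous_def by (metis subset_iff)

lemma end_ext_trans: "end_ext A B \<Longrightarrow> end_ext B C \<Longrightarrow> end_ext A C"
  unfolding end_ext_def by blast

lemma end_ext_refl: "end_ext A A"
  unfolding end_ext_def by blast

lemma end_ext_Int_lessThan:
  assumes "end_ext A B" "x \<in> A"
  shows "B \<inter> {..<x} = A \<inter> {..<x}"
  using assms unfolding end_ext_def by (auto dest: order.asym)

definition alternating :: "bool \<Rightarrow> coloring \<Rightarrow> nat set \<Rightarrow> bool" where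
  "alternating c g Z \<longleftrightarrow> (\<forall>x\<in>Z. \<forall>z\<in>Z. x < z \<and> odd (card (Z \<inter> {..<x}) + card (Z \<inter> {..<z})) \<longrightarrow> g x z = c)"

context thinned
begin

lemma step_end_ext: "step c g D D' \<Longrightarrow> end_ext D D'"
  unfolding step_def ok_def end_ext_def by auto

lemma steps_end_ext: "steps c g D D' \<Longrightarrow> end_ext D D'"
  by (induction rule: rtranclp_induct) (auto intro: end_ext_trans step_end_ext end_ext_refl)

lemma step_card: "step c g D D' \<Longrightarrow> finite D \<Longrightarrow> finite D' \<and> card D' = Suc (card D)"
  unfolding step_def ok_def by auto

lemma step_alternating:
  assumes "step c g D D'" "alternating c g D" "finite D"
  shows "alternating c g D'"
proof -
  obtain a where a: "D' = insert a D" "ok D a" "\<forall>x\<in>D. odd (card (D \<inter> {..<x}) + card D) \<longrightarrow> g x a = c"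
    using assms(1) unfolding step_def by blast
  have gt: "\<forall>e\<in>D. e < a" using a(2) by (simp add: ok_def)
  \<comment> \<open>The new element is the largest, so its rank is \<open>card D\<close> and all
    older ranks are unchanged.\<close>
  have ra: "insert a D \<inter> {..<a} = D" using gt by auto
  have r: "insert a D \<inter> {..<x} = D \<inter> {..<x}" if "x \<in> D" for x using gt that by auto
  show ?thesis
    unfolding alternating_def a(1)
  proof (intro ballI impI)
    fix x z assume x: "x \<in> insert a D" and z: "z \<in> insert a D"
      and xz: "x < z \<and> odd (card (insert a D \<inter> {..<x}) + card (insert a D \<inter> {..<z}))"
    have "x \<in> D" using x z xz gt by auto
    show "g x z = c"
    proof (cases "z = a")
      case True
      then show ?thesis using a(3) \<open>x \<in> D\<close> xz ra r by auto
    next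
      case False
      then show ?thesis using assms(2) \<open>x \<in> D\<close> z xz r unfolding alternating_def by auto
    qed
  qed
qed

lemma steps_finite_alternating: "steps c g {} D \<Longrightarrow> finite D \<and> alternating c g D"
proof (induction rule: rtranclp_induct)
  case base
  then show ?case by (simp add: alternating_def)
next
  case (step D D')
  then show ?case using step_alternating step_card by blast
qed

text \<open>With \<open>j < card D\<close> the definition of \<open>ok\<close> protects quietness of
  \<open>j\<close> at every later step, so no later stage has an output that \<open>D\<close>
  lacks.\<close>

lemma quiet_persists:
  assumes "steps c g D D'" "finite D" "quiet j D" "j < card D"
  shows "quiet j D' \<and> j < card D' \<and> finite D' \<and> (\<forall>y. P j D' y \<longrightarrow> P j D y)"
  using assms(1)
proof (induction rule: rtranclp_induct)
  case base
  then show ?case using assms by simp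
next
  case (step D1 D2)
  then obtain a where "D2 = insert a D1" "ok D1 a" unfolding step_def by blast
  then have "\<not> new j D1 a \<and> quiet j D2" using step.IH unfolding ok_def by auto
  then show ?case using step step_card[OF step.hyps(2)] \<open>D2 = insert a D1\<close> unfolding fresh_def by auto
qed

lemma grow:
  assumes "cnd c g E" "\<exists>\<^sub>F a in tail X. has_lim g a c"
  shows "\<exists>D. steps c g E D \<and> n < card D"
proof (induction n)
  case 0
  obtain a where "step c g E (insert a E)" using extend1[OF assms, of "\<lambda>_. True"] by auto
  then show ?case using step_card[of c g E] assms(1) unfolding cnd_def by (metis r_into_rtranclp zero_less_Suc)
next
  case (Suc n)
  then obtain D where D: "steps c g E D" "n < card D" by blast
  have cD: "cnd c g D" using D(1) assms(1) by (rule steps_cnd)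
  obtain a where a: "step c g D (insert a D)" using extend1[OF cD assms(2), of "\<lambda>_. True"] by auto
  have "steps c g E (insert a D)" using D(1) a by (rule rtranclp.rtrancl_into_rtrancl)
  moreover have "Suc n < card (insert a D)" using step_card[OF a] D(2) cD unfolding cnd_def by auto
  ultimately show ?case by blast
qed

lemma steps_card_mono:
  assumes "steps c g D D'" "finite D"
  shows "finite D' \<and> card D \<le> card D'"
  using assms(1) by (induction rule: rtranclp_induct) (use assms(2) step_card in fastforce)+

lemma fulfill_inhom:
  assumes "inhom f {y. P j D y}" "cnd c g D" "\<exists>\<^sub>F a in tail X. has_lim g a c"
  shows "\<exists>D'. steps c g D D' \<and> inhom f {y. settled j D' y}"
proof -
  obtain y y' z z' where P: "P j D y" "P j D y'" "P j D z" "P j D z'" and *: "y < y'" "z < z'" "f y y' \<noteq> f z z'"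
    using assms(1) unfolding inhom_def by blast
  obtain D' where "steps c g D D'" and st: "\<forall>w\<in>{y, y', z, z'}. settled j D' w"
    using fulfill[of "{y, y', z, z'}" c g D j] P assms(2,3) by auto
  moreover have "inhom f {y. settled j D' y}"
    unfolding inhom_def using st * by (intro bexI[of _ y] bexI[of _ y'] bexI[of _ z] bexI[of _ z']) auto
  ultimately show ?thesis by blast
qed

text \<open>Stage \<open>n\<close> disposes of functional \<open>n\<close>: either two settled pairs
  of outputs differ in color, or the functional is quiet with finitely many outputs and remains so
  in the limit \<open>Z\<close>.\<close>

lemma build:
  assumes freq: "\<exists>\<^sub>F a in tail X. has_lim g a c"
    and inf: "\<And>j E. finite E \<Longrightarrow> infinite {y. P j E y} \<Longrightarrow> inhom f {y. P j E y}"
    and req: "\<And>j E. steps c g {} E \<Longrightarrow> \<exists>D. steps c g E D \<and> (quiet j D \<or> inhom f {y. P j D y})"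
  shows "\<exists>Z. infinite Z \<and> alternating c g Z \<and> (\<forall>j. \<not> homogeneous f {y. Psi j Z y})"
proof -
  define good where "good j D \<longleftrightarrow> (quiet j D \<and> j < card D \<and> finite {y. P j D y}) \<or> inhom f {y. settled j D y}" for j D
  have stage: "\<exists>D. steps c g {} D \<and> steps c g E D \<and> n < card D \<and> good n D" if E: "steps c g {} E" for n E
  proof -
    have cE: "cnd c g E" using E cnd_empty by (rule steps_cnd)
    \<comment> \<open>Growing first puts \<open>n\<close> below the cardinality, where
      \<open>ok\<close> protects it.\<close>
    obtain D1 where D1: "steps c g E D1" "n < card D1" using grow[OF cE freq] by blast
    have rD1: "steps c g {} D1" using E D1(1) by (rule rtranclp_trans)
    obtain D2 where D2: "steps c g D1 D2" "quiet n D2 \<or> inhom f {y. P n D2 y}" using req[OF rD1] by blast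
    have rD2: "steps c g {} D2" using rD1 D2(1) by (rule rtranclp_trans)
    have cD2: "cnd c g D2" using rD2 cnd_empty by (rule steps_cnd)
    have n2: "n < card D2" using steps_card_mono[OF D2(1)] steps_finite_alternating[OF rD1] D1(2) by auto
    have ED2: "steps c g E D2" using D1(1) D2(1) by (rule rtranclp_trans)
    show ?thesis
    proof (cases "inhom f {y. P n D2 y}")
      case True
      from fulfill_inhom[OF this cD2 freq] obtain D3 where D3: "steps c g D2 D3" "inhom f {y. settled n D3 y}" by blast
      have "n < card D3" using steps_card_mono[OF D3(1)] n2 steps_finite_alternating[OF rD2] by auto
      then show ?thesis using D3 rD2 ED2 unfolding good_def by (meson rtranclp_trans)
    next
      case False
      \<comment> \<open>An infinite set of outputs would be inhomogeneous by \<open>inf\<close>,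
        which this case excludes.\<close>
      then have "quiet n D2 \<and> finite {y. P n D2 y}" using D2(2) inf[of D2 n] cD2 unfolding cnd_def by blast
      then show ?thesis using rD2 ED2 n2 unfolding good_def by blast
    qed
  qed
  have "\<exists>s. \<forall>n. steps c g {} (s n) \<and> (steps c g (s n) (s (Suc n)) \<and> n < card (s (Suc n)) \<and> good n (s (Suc n)))"
    by (rule dependent_nat_choice[where P = "\<lambda>_ E. steps c g {} E"]) (use stage in auto)
  then obtain s where s0: "\<And>n. steps c g {} (s n)" and sS: "\<And>n. steps c g (s n) (s (Suc n))"
    and sc: "\<And>n. n < card (s (Suc n))" and sg: "\<And>n. good n (s (Suc n))" by blast
  have smono: "steps c g (s m) (s n)" if "m \<le> n" for m n
    using that by (induction n rule: dec_induct) (auto intro: rtranclp_trans sS)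
  define Z where "Z = (\<Union>n. s n)"
  have sfin: "finite (s n)" for n using steps_finite_alternating[OF s0] by blast
  have sZ: "end_ext (s n) Z" for n
  proof -
    have "\<forall>e\<in>s n. e < z" if "z \<in> s m" "z \<notin> s n" for z m
    proof -
      have "\<not> m \<le> n" using that steps_end_ext[OF smono] unfolding end_ext_def by blast
      then have "end_ext (s n) (s m)" using steps_end_ext[OF smono[of n m]] by simp
      then show ?thesis using that unfolding end_ext_def by blast
    qed
    then show ?thesis unfolding end_ext_def Z_def by blast
  qed
  have Zinf: "infinite Z"
  proof
    assume "finite Z"
    then have "card (s (Suc (card Z))) \<le> card Z" by (rule card_mono) (use sZ in \<open>auto simp: end_ext_def\<close>)
    then show False using sc[of "card Z"] by simp
  qed
  have "alternating c g Z"
    unfolding alternating_def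
  proof (intro ballI impI)
    fix x z assume "x \<in> Z" "z \<in> Z" and xz: "x < z \<and> odd (card (Z \<inter> {..<x}) + card (Z \<inter> {..<z}))"
    then obtain m n where "x \<in> s m" "z \<in> s n" unfolding Z_def by blast
    then have x: "x \<in> s (max m n)" and z: "z \<in> s (max m n)"
      using steps_end_ext[OF smono] unfolding end_ext_def by (meson max.cobounded1 max.cobounded2 subsetD)+
    show "g x z = c"
      using steps_finite_alternating[OF s0[of "max m n"]] xz x z
        end_ext_Int_lessThan[OF sZ x] end_ext_Int_lessThan[OF sZ z] unfolding alternating_def by auto
  qed
  moreover have "\<not> homogeneous f {y. Psi j Z y}" for j
  proof (cases "inhom f {y. settled j (s (Suc j)) y}")
    case True
    then show ?thesis by (rule inhom_not_homogeneous) (use sZ in \<open>auto simp: settled_def\<close>)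
  next
    case False
    then have g: "quiet j (s (Suc j))" "j < card (s (Suc j))" "finite {y. P j (s (Suc j)) y}"
      using sg[of j] unfolding good_def by auto
    \<comment> \<open>By the use principle acceptance of \<open>y\<close> depends on a finite part
      of \<open>Z\<close>, so \<open>y\<close> is settled at some later stage and hence promised
      already when \<open>j\<close> became quiet.\<close>
    have "{y. Psi j Z y} \<subseteq> {y. P j (s (Suc j)) y}"
    proof safe
      fix y assume "Psi j Z y"
      then obtain k where k: "\<And>Z'. Z' \<inter> {..<k} = Z \<inter> {..<k} \<Longrightarrow> Psi j Z' y" using Psi_use by blast
      obtain w where "w \<in> Z" "k \<le> w" using Zinf unfolding infinite_nat_iff_unbounded_le by blast
      then obtain m0 where "w \<in> s m0" unfolding Z_def by blast
      define m where "m = max m0 (Suc j)"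
      have "m0 \<le> m" "Suc j \<le> m" by (simp_all add: m_def)
      have "s m0 \<subseteq> s m" using steps_end_ext[OF smono[OF \<open>m0 \<le> m\<close>]] by (simp add: end_ext_def)
      then have w: "w \<in> s m" using \<open>w \<in> s m0\<close> by (rule subsetD)
      have "Z' \<inter> {..<k} = s m \<inter> {..<k}" if "end_ext (s m) Z'" for Z'
      proof -
        have "z \<in> s m" if "z \<in> Z'" "z < k" for z
          using that \<open>end_ext (s m) Z'\<close> w \<open>k \<le> w\<close> unfolding end_ext_def by (meson DiffI leD less_trans)
        then show ?thesis using that unfolding end_ext_def by blast
      qed
      then have "Z' \<inter> {..<k} = Z \<inter> {..<k}" if "end_ext (s m) Z'" for Z' using sZ[of m] that by simp
      then have "settled j (s m) y" unfolding settled_def using k by blast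
      then show "P j (s (Suc j)) y"
        using quiet_persists[OF smono[OF \<open>Suc j \<le> m\<close>] sfin g(1,2)] settled_P by blast
    qed
    then show ?thesis unfolding homogeneous_def using g(3) finite_subset by blast
  qed
  ultimately show ?thesis using Zinf by blast
qed

text \<open>Some \<open>j\<close> and \<open>E\<close> block the construction. Extending
  \<open>E\<close>, first the color of pairs of outputs becomes constant, then a critical stage is
  reached.\<close>

lemma build_or_bad:
  assumes freq: "\<exists>\<^sub>F a in tail X. has_lim g a c"
    and inf: "\<And>j E. finite E \<Longrightarrow> infinite {y. P j E y} \<Longrightarrow> inhom f {y. P j E y}"
    and no: "\<not> (\<exists>Z. infinite Z \<and> alternating c g Z \<and> (\<forall>j. \<not> homogeneous f {y. Psi j Z y}))"
  shows "\<exists>j d p E. bad c f g j d p E"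
proof -
  have "\<exists>j E. steps c g {} E \<and> (\<forall>D. steps c g E D \<longrightarrow> \<not> quiet j D \<and> \<not> inhom f {y. P j D y})"
  proof (rule ccontr)
    assume "\<not> ?thesis"
    then have req: "\<And>j E. steps c g {} E \<Longrightarrow> \<exists>D. steps c g E D \<and> (quiet j D \<or> inhom f {y. P j D y})" by blast
    from build[OF freq inf req] no show False by simp
  qed
  then obtain j E where E: "steps c g {} E" and nq: "\<And>D. steps c g E D \<Longrightarrow> \<not> quiet j D"
    and ni: "\<And>D. steps c g E D \<Longrightarrow> \<not> inhom f {y. P j D y}" by blast
  have cE: "cnd c g E" using E cnd_empty by (rule steps_cnd)
  \<comment> \<open>If some pair of outputs ever appears, settling it fixes \<open>d\<close>, since
    any other color would give inhomogeneity. If none appears, every \<open>d\<close> works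
    vacuously.\<close>
  have "\<exists>D1 d. steps c g E D1 \<and> (\<forall>D y z. steps c g D1 D \<and> P j D y \<and> P j D z \<and> y < z \<longrightarrow> f y z = d)"
  proof (cases "\<exists>D y z. steps c g E D \<and> P j D y \<and> P j D z \<and> y < z")
    case True
    then obtain D y z where D: "steps c g E D" "P j D y" "P j D z" "y < z" by blast
    obtain D1 where D1: "steps c g D D1" "settled j D1 y" "settled j D1 z"
      using fulfill[of "{y, z}" c g D j] steps_cnd[OF D(1) cE] freq D by auto
    have ED1: "steps c g E D1" using D(1) D1(1) by (rule rtranclp_trans)
    have "f y' z' = f y z" if h: "steps c g D1 D2" "P j D2 y'" "P j D2 z'" "y' < z'" for D2 y' z'
    proof (rule ccontr)
      assume ne: "f y' z' \<noteq> f y z"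
      have "P j D2 y" "P j D2 z" using steps_settled[OF h(1)] D1 settled_P by blast+
      then have "inhom f {y. P j D2 y}" unfolding inhom_def using ne h D(4) by blast
      then show False using ni[OF rtranclp_trans[OF ED1 h(1)]] by blast
    qed
    then show ?thesis using ED1 by blast
  next
    case False
    then show ?thesis by blast
  qed
  then obtain D1 d where D1: "steps c g E D1"
    and d: "\<forall>D y z. steps c g D1 D \<and> P j D y \<and> P j D z \<and> y < z \<longrightarrow> f y z = d" by (elim exE conjE)
  have "\<exists>D2 p. steps c g D1 D2 \<and> crit j p D2"
    by (rule crit_exists[OF steps_cnd[OF D1 cE] freq]) (use nq rtranclp_trans[OF D1] in blast)
  then obtain D2 p where D2: "steps c g D1 D2" "crit j p D2" by blast
  have ED2: "steps c g E D2" using D1 D2(1) by (rule rtranclp_trans)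
  have "bad c f g j d p D2"
    unfolding bad_def
  proof (intro conjI allI impI)
    show "steps c g {} D2" using E ED2 by (rule rtranclp_trans)
    show "f y z = d" if "steps c g D2 D \<and> P j D y \<and> P j D z \<and> y < z" for D y z
      using d that rtranclp_trans[OF D2(1), of D] by blast
    show "\<not> quiet j D" if "steps c g D2 D" for D
      using nq[OF rtranclp_trans[OF ED2 that]] .
  qed (use freq D2(2) in auto)
  then show ?thesis by blast
qed

end

subsection \<open>Generic stable colorings\<close>

text \<open>A forcing condition: \<open>g\<close> up to \<open>N\<close> together with the commitment that every \<open>x < N\<close> has limit color \<open>g x N\<close>.\<close>

definition cyl :: "coloring \<Rightarrow> nat \<Rightarrow> coloring set" where
  "cyl g N = {f. \<forall>x z. x < N \<and> x < z \<longrightarrow> f x z = g x (min z N)}"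

lemma cylD: "f \<in> cyl g N \<Longrightarrow> x < N \<Longrightarrow> x < z \<Longrightarrow> f x z = g x (min z N)"
  by (simp add: cyl_def)

lemma cyl_trans:
  assumes "g \<in> cyl g0 N0" "N0 \<le> N" "f \<in> cyl g N"
  shows "f \<in> cyl g0 N0"
  unfolding cyl_def
proof (intro CollectI allI impI)
  fix x z assume x: "x < N0 \<and> x < z"
  have "f x z = g x (min z N)" using cylD[OF assms(3)] x assms(2) by simp
  also have "\<dots> = g0 x (min z N0)"
    using cylD[OF assms(1), of x "min z N"] x assms(2) by (simp add: min.assoc min_absorb2)
  finally show "f x z = g0 x (min z N0)" .
qed

lemma cyl_eq:
  assumes "f \<in> cyl g N"
  shows "cyl f N = cyl g N"
proof -
  have "f x (min z N) = g x (min z N)" if "x < N" "x < z" for x z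
    using cylD[OF assms, of x "min z N"] that by simp
  then show ?thesis unfolding cyl_def by (auto simp del: min_less_iff_conj)
qed

lemma cyl_agree: "f \<in> cyl g N \<Longrightarrow> agree N f g"
  unfolding agree_def by (simp add: cylD)

lemma cyl_has_lim: "f \<in> cyl g N \<Longrightarrow> w < N \<Longrightarrow> has_lim f w (g w N)"
  unfolding has_lim_def eventually_at_top_linorder by (intro exI[of _ N]) (simp add: cylD)

text \<open>\<open>g\<close> itself may violate the commitment and lie outside
  \<open>cyl g N\<close>; freezing it from \<open>N\<close> on gives a canonical member.\<close>

lemma cyl_retract: "(\<lambda>x z. g x (min z N)) \<in> cyl g N"
  by (simp add: cyl_def)

definition dense_cyl :: "(coloring \<Rightarrow> nat \<Rightarrow> bool) \<Rightarrow> bool" where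
  "dense_cyl D \<longleftrightarrow> (\<forall>g N. \<exists>g' N'. N \<le> N' \<and> g' \<in> cyl g N \<and> D g' N')"

text \<open>Meeting countably many dense sets along a descending sequence of conditions; lengths
  tending to infinity make the limit coloring well defined.\<close>

lemma generic_exists:
  assumes "\<And>n. dense_cyl (D n)"
  shows "\<exists>f. \<forall>n. \<exists>g N. n \<le> N \<and> f \<in> cyl g N \<and> D n g N"
proof -
  have ext: "\<exists>g' N'. N \<le> N' \<and> k \<le> N' \<and> g' \<in> cyl g N \<and> D n g' N'" for n k g N
  proof -
    obtain g' N' where "max N k \<le> N'" "g' \<in> cyl (\<lambda>x z. g x (min z N)) (max N k)" "D n g' N'"
      using assms[of n] unfolding dense_cyl_def by blast
    then show ?thesis using cyl_trans[OF cyl_retract, of N "max N k" g' g] by auto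
  qed
  have "\<exists>s. \<forall>n. n \<le> snd (s n) \<and> (snd (s n) \<le> snd (s (Suc n)) \<and> fst (s (Suc n)) \<in> cyl (fst (s n)) (snd (s n))
      \<and> D n (fst (s (Suc n))) (snd (s (Suc n))))"
  proof (rule dependent_nat_choice)
    show "\<exists>x :: coloring \<times> nat. 0 \<le> snd x" by simp
  next
    fix x :: "coloring \<times> nat" and n assume "n \<le> snd x"
    obtain g1 N1 where 1: "snd x \<le> N1" "Suc n \<le> N1" "g1 \<in> cyl (fst x) (snd x)" "D n g1 N1" using ext by blast
    show "\<exists>y. Suc n \<le> snd y \<and> (snd x \<le> snd y \<and> fst y \<in> cyl (fst x) (snd x) \<and> D n (fst y) (snd y))"
      by (rule exI[of _ "(g1, N1)"]) (simp add: 1)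
  qed
  then obtain s where s: "\<And>n. n \<le> snd (s n)" "\<And>n. snd (s n) \<le> snd (s (Suc n))"
    "\<And>n. fst (s (Suc n)) \<in> cyl (fst (s n)) (snd (s n))" "\<And>n. D n (fst (s (Suc n))) (snd (s (Suc n)))"
    by blast
  \<comment> \<open>The inequality between the indices is strict because a coloring need not lie in
    its own cylinder.\<close>
  have mono: "snd (s m) \<le> snd (s n) \<and> fst (s n) \<in> cyl (fst (s m)) (snd (s m))" if "Suc m \<le> n" for m n
    using that
  proof (induction n rule: dec_induct)
    case base
    then show ?case using s by blast
  next
    case (step n)
    then show ?case using s(2)[of n] cyl_trans[OF _ _ s(3)[of n]] by fastforce
  qed
  \<comment> \<open>The condition at stage \<open>Suc z\<close> is longer than \<open>z\<close>, so
    the color of a pair below \<open>Suc z\<close> no longer changes.\<close>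
  define f where "f x z = fst (s (Suc z)) x z" for x z
  have f: "f \<in> cyl (fst (s m)) (snd (s m))" for m
    unfolding cyl_def
  proof (intro CollectI allI impI)
    fix x z assume x: "x < snd (s m) \<and> x < z"
    define K where "K = Suc (max m z)"
    have "f x z = fst (s K) x z"
    proof (cases "Suc z = K")
      case False
      then have "Suc (Suc z) \<le> K" by (auto simp: K_def)
      moreover have "z < snd (s (Suc z))" using s(1)[of "Suc z"] by simp
      ultimately show ?thesis using cylD[of "fst (s K)" "fst (s (Suc z))" "snd (s (Suc z))" x z] mono x
        by (auto simp: f_def)
    qed (simp add: f_def)
    also have "\<dots> = fst (s m) x (min z (snd (s m)))"
      using mono[of m K] x by (intro cylD) (auto simp: K_def)
    finally show "f x z = fst (s m) x (min z (snd (s m)))" .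
  qed
  have "n \<le> snd (s (Suc n))" for n using s(1)[of "Suc n"] by simp
  then show ?thesis using f s(4) by blast
qed

section \<open>Deciding computations by conditions\<close>

context functionals
begin

text \<open>Divergence is read as \<open>False\<close>, so this is the computed coloring only under
  \<open>tot\<close>.\<close>

definition val :: "nat \<Rightarrow> coloring \<Rightarrow> coloring" where
  "val i f a u \<longleftrightarrow> a < u \<and> Phi i f a u True"

definition tot :: "nat \<Rightarrow> coloring \<Rightarrow> bool" where
  "tot i f \<longleftrightarrow> (\<forall>a u. a < u \<longrightarrow> (\<exists>c. Phi i f a u c))"

lemma val_eqI: "Phi i f a u c \<Longrightarrow> a < u \<Longrightarrow> val i f a u = c"
  unfolding val_def using Phi_fun[of i f a u c True] by auto

lemma tot_val: "tot i f \<Longrightarrow> a < u \<Longrightarrow> Phi i f a u (val i f a u)"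
  unfolding tot_def using val_eqI by blast

text \<open>1-genericity for this forcing: \<open>f\<close> respects its own limit commitments at
  arbitrarily large lengths, and a color that fails to appear beyond \<open>m\<close> is excluded by
  a condition.\<close>

definition generic :: "coloring \<Rightarrow> bool" where
  "generic f \<longleftrightarrow> (\<forall>n. \<exists>N\<ge>n. f \<in> cyl f N) \<and>
    (\<forall>i a m c. (\<exists>u\<ge>m. a < u \<and> Phi i f a u c) \<or>
      (\<exists>N. f \<in> cyl f N \<and> (\<forall>h\<in>cyl f N. \<forall>u\<ge>m. a < u \<longrightarrow> \<not> Phi i h a u c)))"

definition decides :: "nat \<Rightarrow> nat \<Rightarrow> nat \<Rightarrow> bool \<Rightarrow> coloring \<Rightarrow> nat \<Rightarrow> bool" where
  "decides i a m c g N \<longleftrightarrow> (\<forall>h\<in>cyl g N. \<exists>u\<ge>m. a < u \<and> Phi i h a u c) \<or>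
     (\<forall>h\<in>cyl g N. \<forall>u\<ge>m. a < u \<longrightarrow> \<not> Phi i h a u c)"

lemma dense_decides: "dense_cyl (decides i a m c)"
  unfolding dense_cyl_def
proof (intro allI)
  fix g N
  show "\<exists>g' N'. N \<le> N' \<and> g' \<in> cyl g N \<and> decides i a m c g' N'"
  proof (cases "\<exists>h\<in>cyl g N. \<exists>u\<ge>m. a < u \<and> Phi i h a u c")
    case True
    then obtain h u where h: "h \<in> cyl g N" "m \<le> u" "a < u" "Phi i h a u c" by blast
    obtain k where k: "\<And>h'. agree k h h' \<Longrightarrow> Phi i h' a u c" using Phi_use[OF h(4)] by blast
    have "agree k h h'" if "h' \<in> cyl h (max N k)" for h'
      using cyl_agree[OF that] unfolding agree_def by (auto simp: less_max_iff_disj)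
    then have "decides i a m c h (max N k)" unfolding decides_def using k h(2,3) by blast
    then show ?thesis using h(1) by (intro exI[of _ h] exI[of _ "max N k"]) simp
  next
    case False
    then have "decides i a m c (\<lambda>x z. g x (min z N)) N"
      unfolding decides_def cyl_eq[OF cyl_retract] by blast
    then show ?thesis using cyl_retract by blast
  qed
qed

lemma genericI:
  assumes "\<And>n. \<exists>g N. n \<le> N \<and> f \<in> cyl g N" "\<And>i a m c. \<exists>g N. f \<in> cyl g N \<and> decides i a m c g N"
  shows "generic f"
proof -
  have self: "f \<in> cyl f N" if "f \<in> cyl g N" for g N using that cyl_eq by blast
  have "\<exists>N\<ge>n. f \<in> cyl f N" for n using assms(1)[of n] self by blast
  moreover have "(\<exists>u\<ge>m. a < u \<and> Phi i f a u c) \<or>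
      (\<exists>N. f \<in> cyl f N \<and> (\<forall>h\<in>cyl f N. \<forall>u\<ge>m. a < u \<longrightarrow> \<not> Phi i h a u c))" for i a m c
  proof -
    obtain g N where g: "f \<in> cyl g N" "decides i a m c g N" using assms(2) by blast
    show ?thesis using g(2) unfolding decides_def cyl_eq[OF g(1), symmetric] using self[OF g(1)] by blast
  qed
  ultimately show ?thesis unfolding generic_def by blast
qed

lemma generic_stable:
  assumes "generic f"
  shows "stable f"
  unfolding stable_has_lim
proof
  fix a
  obtain N where "Suc a \<le> N" "f \<in> cyl f N" using assms unfolding generic_def by blast
  then show "\<exists>c. has_lim f a c" using cyl_has_lim[of f f N a] by auto
qed

text \<open>Beyond some \<open>m\<close> the color \<open>\<not> c\<close> does not appear, and
  genericity makes this hold on a whole cylinder. The modulus of one coloring thus serves all its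
  total neighbors.\<close>

lemma generic_modulus:
  assumes gen: "generic f" and tot: "tot i f" and lim: "has_lim (val i f) a c"
  shows "\<exists>M. \<forall>N\<ge>M. f \<in> cyl f N \<longrightarrow> (\<forall>h\<in>cyl f N. tot i h \<longrightarrow> (\<forall>u\<ge>M. a < u \<longrightarrow> val i h a u = c))"
proof -
  obtain m where m: "\<And>u. m \<le> u \<Longrightarrow> val i f a u = c"
    using lim unfolding has_lim_def eventually_at_top_linorder by blast
  have "\<not> (\<exists>u\<ge>m. a < u \<and> Phi i f a u (\<not> c))" using m val_eqI by blast
  then obtain N1 where N1: "f \<in> cyl f N1" "\<forall>h\<in>cyl f N1. \<forall>u\<ge>m. a < u \<longrightarrow> \<not> Phi i h a u (\<not> c)"
    using gen unfolding generic_def by blast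
  have "val i h a u = c" if "max m N1 \<le> N" "h \<in> cyl f N" "tot i h" "max m N1 \<le> u" "a < u" for N h u
  proof -
    have "h \<in> cyl f N1" using cyl_trans[OF N1(1) _ that(2)] that(1) by simp
    then have "\<not> Phi i h a u (\<not> c)" using N1(2) that(4,5) by simp
    then show ?thesis using tot_val[OF that(3,5)] by (cases c; cases "val i h a u") simp_all
  qed
  then show ?thesis by blast
qed

lemma val_use:
  assumes "tot i f" "a < u"
  shows "\<exists>k. \<forall>h. agree k f h \<longrightarrow> val i h a u = val i f a u"
  using Phi_use[OF tot_val[OF assms]] val_eqI assms(2) by blast

end

lemma dense_inhom:
  assumes "infinite S"
  shows "dense_cyl (\<lambda>g N. \<forall>h\<in>cyl g N. inhom h S)"
  unfolding dense_cyl_def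
proof (intro allI)
  fix g N
  have nxt: "\<exists>z\<in>S. k < z" for k using assms infinite_nat_iff_unbounded by auto
  obtain y where y: "y \<in> S" "N < y" using nxt by blast
  obtain y' where y': "y' \<in> S" "y < y'" using nxt by blast
  obtain z where z: "z \<in> S" "y' < z" using nxt by blast
  obtain z' where z': "z' \<in> S" "z < z'" using nxt by blast
  \<comment> \<open>For the four numbers taken from \<open>S\<close> above \<open>N\<close>, the
    pair \<open>y\<close>, \<open>y'\<close> gets \<open>False\<close> and the pair
    \<open>z\<close>, \<open>z'\<close> gets \<open>True\<close>.\<close>
  define g' where "g' x w = (if x < N then g x (min w N) else x = z)" for x w
  have "inhom h S" if h: "h \<in> cyl g' (Suc z')" for h
  proof -
    have "h y y' = g' y y'" "h z z' = g' z z'" using cylD[OF h, of y y'] cylD[OF h, of z z'] y y' z z' by simp_all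
    then have "h y y' \<noteq> h z z'" using y y' z z' by (simp add: g'_def)
    then show ?thesis unfolding inhom_def using y y' z z' by blast
  qed
  moreover have "g' \<in> cyl g N" by (simp add: cyl_def g'_def)
  moreover have "N \<le> Suc z'" using y y' z z' by simp
  ultimately show "\<exists>g' N'. N \<le> N' \<and> g' \<in> cyl g N \<and> (\<forall>h\<in>cyl g' N'. inhom h S)" by blast
qed

subsection \<open>Bad colorings are nowhere dense\<close>

context functionals
begin

lemma uniform_modulus:
  assumes f: "generic f" "tot i f" and "finite C" and lim: "\<forall>x\<in>C. has_lim (val i f) x c"
  shows "\<exists>M. \<forall>N\<ge>M. f \<in> cyl f N \<longrightarrow> (\<forall>h\<in>cyl f N. tot i h \<longrightarrow> (\<forall>x\<in>C. \<forall>u\<ge>N. x < u \<longrightarrow> val i h x u = c))"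
proof -
  have "\<forall>x\<in>C. \<exists>M. \<forall>N\<ge>M. f \<in> cyl f N \<longrightarrow> (\<forall>h\<in>cyl f N. tot i h \<longrightarrow> (\<forall>u\<ge>M. x < u \<longrightarrow> val i h x u = c))"
    using generic_modulus[OF f] lim by blast
  then obtain M where M: "\<forall>x\<in>C. \<forall>N\<ge>M x. f \<in> cyl f N \<longrightarrow>
      (\<forall>h\<in>cyl f N. tot i h \<longrightarrow> (\<forall>u\<ge>M x. x < u \<longrightarrow> val i h x u = c))" by metis
  obtain k where k: "\<forall>x\<in>C. M x < k" using \<open>finite C\<close> finite_nat_set_iff_bounded[of "M ` C"] by auto
  have "val i h x u = c" if "k \<le> N" "f \<in> cyl f N" "h \<in> cyl f N" "tot i h" "x \<in> C" "N \<le> u" "x < u" for N h x u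
  proof -
    have "M x \<le> N" "M x \<le> u" using k that by fastforce+
    then show ?thesis using M that by blast
  qed
  then show ?thesis by blast
qed

lemma uniform_use:
  assumes "tot i f" "finite C" "\<And>x. x \<in> C \<Longrightarrow> x < u"
  shows "\<exists>k. \<forall>h. agree k f h \<longrightarrow> (\<forall>x\<in>C. val i h x u = val i f x u)"
proof -
  have "\<forall>x\<in>C. \<exists>k. \<forall>h. agree k f h \<longrightarrow> val i h x u = val i f x u"
    using val_use[OF assms(1)] assms(3) by blast
  then obtain K where K: "\<forall>x\<in>C. \<forall>h. agree (K x) f h \<longrightarrow> val i h x u = val i f x u" by metis
  obtain k where k: "\<forall>x\<in>C. K x < k" using \<open>finite C\<close> finite_nat_set_iff_bounded[of "K ` C"] by auto
  have "agree (K x) f h" if "agree k f h" "x \<in> C" for h x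
    using that k unfolding agree_def by (meson less_trans)
  then show ?thesis using K by blast
qed

end

text \<open>A cylinder in which colorings bad with the same parameters are dense. The last
  assumption supplies guards: giving \<open>w\<close> the limit \<open>v\<close> under
  \<open>f\<close> forces \<open>a\<close> to have limit \<open>c\<close> under the computed
  coloring.\<close>

locale bad_region = thinned +
  fixes i :: nat and B :: "coloring set" and g0 :: coloring and N0 :: nat
    and c d p v :: bool and j :: nat and E :: "nat set"
  assumes generic: "f \<in> B \<Longrightarrow> generic f" and total: "f \<in> B \<Longrightarrow> tot i f"
    and dense: "N0 \<le> N \<Longrightarrow> h \<in> cyl g0 N0 \<Longrightarrow> \<exists>f\<in>B. f \<in> cyl h N"
    and bad: "f \<in> B \<Longrightarrow> bad c f (val i f) j d p E"
    and E_lim: "f \<in> B \<Longrightarrow> f \<in> cyl g0 N0 \<Longrightarrow> x \<in> E \<Longrightarrow> N0 \<le> u \<Longrightarrow> val i f x u = c"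
    and E_less: "x \<in> E \<Longrightarrow> x < N0"
    and guarded: "\<forall>\<^sub>F a in tail X. \<exists>w\<ge>n. \<forall>f\<in>B. f \<in> cyl g0 N0 \<longrightarrow> has_lim f w v \<longrightarrow> has_lim (val i f) a c"
begin

definition guard :: "nat \<Rightarrow> nat \<Rightarrow> bool" where
  "guard w a \<longleftrightarrow> (\<forall>f\<in>B. f \<in> cyl g0 N0 \<longrightarrow> has_lim f w v \<longrightarrow> has_lim (val i f) a c)"

lemma eventually_guard: "\<forall>\<^sub>F a in tail X. \<exists>w\<ge>n. guard w a"
  using guarded unfolding guard_def .

text \<open>\<open>y\<close> is an output caused by \<open>a0\<close>. All elements of \<open>D\<close> other than \<open>a0\<close> have the right limit color whichever limit \<open>y\<close> is given,
  since their guards differ from \<open>y\<close>; so the limit of \<open>y\<close> may be changed temporarily while \<open>D\<close> is extended on the side of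
  \<open>a0\<close>, where compatibility with \<open>a0\<close> is not required.\<close>

definition state :: "nat \<Rightarrow> nat \<Rightarrow> nat set \<Rightarrow> coloring \<Rightarrow> nat \<Rightarrow> bool" where
  "state a0 y D h N \<longleftrightarrow> N0 \<le> y \<and> y < N \<and> h \<in> cyl g0 N0 \<and> h y N = v \<and> finite D \<and> (\<forall>x\<in>D. x < N) \<and>
    E \<subseteq> D \<and> a0 \<in> D \<and> D \<inter> {..<a0} = E \<and> P j D y \<and>
    (\<forall>x\<in>D - E. \<exists>w<N. h w N = v \<and> (x \<noteq> a0 \<longrightarrow> w \<noteq> y) \<and> guard w x) \<and>
    (\<forall>f\<in>B. f \<in> cyl g0 N0 \<longrightarrow> agree N f h \<longrightarrow> (\<forall>x\<in>D - E. has_lim (val i f) x c) \<longrightarrow> steps c (val i f) E D)"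

text \<open>One round of extension: switch the limit of \<open>y\<close> if the coming rank has the
  parity of \<open>a0\<close>, pass to a member of \<open>B\<close>, add \<open>b\<close>, and
  switch the limit back.\<close>

lemma advance:
  assumes S: "state a0 y D h N" and p: "even (card E) = p" and Q: "eventually Q (tail X)"
  shows "\<exists>b h' N'. Q b \<and> state a0 y (insert b D) h' N' \<and>
    (new j D b \<and> even (card D) = p \<longrightarrow> (\<exists>y'. P j (insert b D) y' \<and> y < y' \<and> y' < N' \<and> h' y y' \<noteq> v))"
proof -
  note S' = S[unfolded state_def]
  have yN: "N0 \<le> y" "y < N" and h: "h \<in> cyl g0 N0" "h y N = v" and D: "finite D" "\<And>x. x \<in> D \<Longrightarrow> x < N"
    and ED: "E \<subseteq> D" "a0 \<in> D" "D \<inter> {..<a0} = E" and Py: "P j D y" using S' by auto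
  have Dg: "\<And>x. x \<in> D - E \<Longrightarrow> \<exists>w<N. h w N = v \<and> (x \<noteq> a0 \<longrightarrow> w \<noteq> y) \<and> guard w x" using S' by blast
  have Dst: "steps c (val i f) E D" if "f \<in> B" "f \<in> cyl g0 N0" "agree N f h" "\<forall>x\<in>D - E. has_lim (val i f) x c" for f
    using S' that by blast
  \<comment> \<open>The temporary limit of \<open>y\<close>, wrong exactly when the coming rank has
    the parity of the rank of \<open>a0\<close>.\<close>
  define s where "s = (if even (card D) = p then \<not> v else v)"
  define C where "C = {x\<in>D. odd (card (D \<inter> {..<x}) + card D)}"
  define h1 where "h1 x z = (if x = y \<and> N \<le> z then s else h x z)" for x z
  have h1: "h1 \<in> cyl g0 N0" using h(1) yN unfolding cyl_def h1_def by auto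
  have N0N: "N0 \<le> N" using yN by simp
  obtain f1 where f1: "f1 \<in> B" "f1 \<in> cyl h1 N" using dense[OF N0N h1] by blast
  have f1g: "f1 \<in> cyl g0 N0" using cyl_trans[OF h1 N0N f1(2)] .
  have C: "finite C" "C \<subseteq> D" using D(1) by (auto simp: C_def)
  have limC: "has_lim (val i f1) x c" if xC: "x \<in> C" for x
  proof (cases "x \<in> E")
    case True
    then show ?thesis using E_lim[OF f1(1) f1g True]
      unfolding has_lim_def eventually_at_top_linorder by blast
  next
    case False
    then obtain w where w: "w < N" "h w N = v" "x \<noteq> a0 \<longrightarrow> w \<noteq> y" "guard w x" using Dg[of x] xC C(2) by blast
    \<comment> \<open>Only \<open>a0\<close> may be guarded by \<open>y\<close>. If
      \<open>a0\<close> belongs to \<open>C\<close>, the coming rank has the opposite parity, so the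
      limit of \<open>y\<close> was not switched.\<close>
    have "h1 w N = v"
    proof (cases "w = y")
      case True
      then have "x = a0" using w(3) by blast
      then have "odd (card E + card D)" using xC ED(3) by (simp add: C_def)
      then have "s = v" using p by (auto simp: s_def)
      then show ?thesis using True by (simp add: h1_def)
    qed (simp add: h1_def w(2))
    then have "has_lim f1 w v" using cyl_has_lim[OF f1(2) w(1)] by simp
    then show ?thesis using w(4) f1(1) f1g unfolding guard_def by blast
  qed
  obtain M where M: "\<forall>N\<ge>M. f1 \<in> cyl f1 N \<longrightarrow>
      (\<forall>h\<in>cyl f1 N. tot i h \<longrightarrow> (\<forall>x\<in>C. \<forall>u\<ge>N. x < u \<longrightarrow> val i h x u = c))"
    using uniform_modulus[OF generic total C(1)] f1(1) limC by blast
  obtain N1 where "max N M \<le> N1" "f1 \<in> cyl f1 N1" using generic[OF f1(1)] unfolding generic_def by blast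
  then have N1: "N \<le> N1" "f1 \<in> cyl f1 N1"
    and mod: "\<forall>h\<in>cyl f1 N1. tot i h \<longrightarrow> (\<forall>x\<in>C. \<forall>u\<ge>N1. x < u \<longrightarrow> val i h x u = c)"
    using M by auto
  have "\<forall>\<^sub>F b in tail X. Q b \<and> ok D b \<and> P j (insert b D) y \<and> N1 \<le> b \<and> (\<exists>w\<ge>N1. guard w b) \<and>
      (new j D b \<longrightarrow> (\<exists>y'\<ge>N1. P j (insert b D) y' \<and> \<not> P j D y'))"
    by (intro eventually_conj Q eventually_ok P_keep new_large eventually_guard eventually_tail_ge D(1) Py)
  from eventually_happens'[OF tail_neq_bot[OF X_inf] this] obtain b where
    b: "Q b" "ok D b" "P j (insert b D) y" "N1 \<le> b" and ex: "\<exists>w\<ge>N1. guard w b"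
    and out: "new j D b \<longrightarrow> (\<exists>y'\<ge>N1. P j (insert b D) y' \<and> \<not> P j D y')" by blast
  obtain w where w: "N1 \<le> w" "guard w b" using ex by blast
  have "\<exists>y'. N1 \<le> y' \<and> (new j D b \<longrightarrow> P j (insert b D) y')"
  proof (cases "new j D b")
    case True
    then show ?thesis using out by fast
  qed auto
  then obtain y' where y': "N1 \<le> y'" "new j D b \<longrightarrow> P j (insert b D) y'" by (elim exE conjE)
  define N2 where "N2 = Suc (max (max b w) y')"
  have N2: "b < N2" "w < N2" "y' < N2" "N1 \<le> N2" using b(4) by (auto simp: N2_def)
  \<comment> \<open>Every number from \<open>N1\<close> on, in particular the guard \<open>w\<close>
    of \<open>b\<close>, gets limit \<open>v\<close>; smaller ones keep the commitments of
    \<open>f1\<close>.\<close>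
  define h2 where "h2 x z = (if N1 \<le> x then v else f1 x z)" for x z
  have h2: "h2 \<in> cyl f1 N1"
    unfolding cyl_def
  proof (intro CollectI allI impI)
    fix x z assume "x < N1 \<and> x < z"
    then show "h2 x z = f1 x (min z N1)" using cylD[OF N1(2), of x z] by (simp add: h2_def)
  qed
  have N0N1: "N0 \<le> N1" using N0N N1(1) by simp
  have h2g: "h2 \<in> cyl g0 N0" using cyl_trans[OF f1g N0N1 h2] .
  \<comment> \<open>Back in \<open>B\<close> the functional is total, so the colors of
    \<open>b\<close> with the elements of \<open>C\<close> are actually computed, with a finite
    use.\<close>
  obtain f2 where f2: "f2 \<in> B" "f2 \<in> cyl h2 N2" using dense[OF _ h2g, of N2] N0N1 N2(4) by auto
  have f21: "f2 \<in> cyl f1 N1" using cyl_trans[OF h2 N2(4) f2(2)] .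
  have f2g: "f2 \<in> cyl g0 N0" using cyl_trans[OF f1g N0N1 f21] .
  have f2N: "f2 x z = h1 x (min z N)" if "x < N" "x < z" for x z
  proof -
    have "f2 x z = f1 x (min z N1)" using cylD[OF f21, of x z] that N1(1) by simp
    also have "\<dots> = h1 x (min (min z N1) N)" using cylD[OF f1(2), of x "min z N1"] that N1(1) by simp
    finally show ?thesis using N1(1) by (simp add: min.assoc min_absorb2)
  qed
  have xb: "x < b" if "x \<in> D" for x using D(2)[OF that] N1(1) b(4) by simp
  have val2: "val i f2 x b = c" if "x \<in> C" for x
    using mod f21 total[OF f2(1)] that b(4) xb C(2) by blast
  obtain k where k: "\<And>h. agree k f2 h \<Longrightarrow> \<forall>x\<in>C. val i h x b = val i f2 x b"
    using uniform_use[OF total[OF f2(1)] C(1), of b] xb C(2) by blast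
  define N3 where "N3 = max k N2"
  have N3: "k \<le> N3" "N2 \<le> N3" by (simp_all add: N3_def)
  \<comment> \<open>The limit of \<open>y\<close> returns to \<open>v\<close>. Since
    \<open>N3\<close> is past the use \<open>k\<close>, the colors computed for \<open>b\<close>
    survive.\<close>
  define h3 where "h3 x z = (if x = y \<and> N3 \<le> z then v else f2 x z)" for x z
  have h3: "h3 \<in> cyl g0 N0" using f2g yN unfolding cyl_def h3_def by auto
  have agr: "agree N3 f2 h3" unfolding agree_def h3_def by auto
  have "state a0 y (insert b D) h3 N3"
    unfolding state_def
  proof (intro conjI)
    show "N0 \<le> y" "h3 \<in> cyl g0 N0" "finite (insert b D)" "E \<subseteq> insert b D" "a0 \<in> insert b D" "P j (insert b D) y"
      using yN h3 D(1) ED b(3) by auto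
    show "y < N3" using yN N1(1) N2(4) N3(2) by simp
    show "h3 y N3 = v" by (simp add: h3_def)
    show "\<forall>x\<in>insert b D. x < N3" using xb N2(1) N3(2) by fastforce
    show "insert b D \<inter> {..<a0} = E" using ED(3) xb[OF ED(2)] by auto
    show "\<forall>x\<in>insert b D - E. \<exists>w<N3. h3 w N3 = v \<and> (x \<noteq> a0 \<longrightarrow> w \<noteq> y) \<and> guard w x"
    proof
      fix x assume x: "x \<in> insert b D - E"
      show "\<exists>w<N3. h3 w N3 = v \<and> (x \<noteq> a0 \<longrightarrow> w \<noteq> y) \<and> guard w x"
      proof (cases "x = b")
        case True
        have "h3 w N3 = v"
        proof -
          have "f2 w N3 = h2 w (min N3 N2)" using cylD[OF f2(2), of w N3] N2(2) N3(2) by simp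
          then show ?thesis using w(1) by (simp add: h3_def h2_def)
        qed
        then show ?thesis using True w N2(2) N3(2) yN N1(1) by (intro exI[of _ w]) auto
      next
        case False
        then obtain w' where w': "w' < N" "h w' N = v" "x \<noteq> a0 \<longrightarrow> w' \<noteq> y" "guard w' x" using Dg x by blast
        have lt: "w' < N3" using w'(1) N1(1) N2(4) N3(2) by simp
        have "h3 w' N3 = v"
        proof (cases "w' = y")
          case False
          have "f2 w' N3 = h1 w' (min N3 N)" using f2N[of w' N3] w'(1) lt by simp
          also have "min N3 N = N" using N1(1) N2(4) N3(2) by simp
          finally show ?thesis using False w'(2) by (simp add: h3_def h1_def)
        qed (simp add: h3_def)
        then show ?thesis using w' lt by blast
      qed
    qed
    show "\<forall>f\<in>B. f \<in> cyl g0 N0 \<longrightarrow> agree N3 f h3 \<longrightarrow> (\<forall>x\<in>insert b D - E. has_lim (val i f) x c) \<longrightarrow>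
        steps c (val i f) E (insert b D)"
    proof (intro ballI impI)
      fix f assume f: "f \<in> B" "f \<in> cyl g0 N0" "agree N3 f h3" and lim: "\<forall>x\<in>insert b D - E. has_lim (val i f) x c"
      have "f x z = h x z" if "x < z" "z < N" for x z
      proof -
        have "z < N3" using that N1(1) N2(4) N3(2) by simp
        then have "f x z = f2 x z" using f(3) agr that unfolding agree_def by simp
        also have "\<dots> = h1 x (min z N)" using f2N[of x z] that by simp
        finally show ?thesis using that by (simp add: h1_def)
      qed
      then have "agree N f h" by (simp add: agree_def)
      then have st: "steps c (val i f) E D" using Dst f lim by blast
      have "b \<notin> E" using xb ED(1) by blast
      have "agree k f2 f" using f(3) agr N3(1) unfolding agree_def by auto
      then have "\<forall>x\<in>C. val i f x b = c" using k val2 by blast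
      then have "step c (val i f) D (insert b D)"
        unfolding step_def using b(2) lim \<open>b \<notin> E\<close> by (intro exI[of _ b]) (auto simp: C_def)
      with st show "steps c (val i f) E (insert b D)" by (rule rtranclp.rtrancl_into_rtrancl)
    qed
  qed
  moreover have "\<exists>y'. P j (insert b D) y' \<and> y < y' \<and> y' < N3 \<and> h3 y y' \<noteq> v" if "new j D b \<and> even (card D) = p"
  proof (intro exI conjI)
    show "P j (insert b D) y'" using that y'(2) by blast
    show lt: "y < y'" using yN N1(1) y'(1) by simp
    show lt3: "y' < N3" using N2(3) N3(2) by simp
    have "h3 y y' = f2 y y'" using lt3 by (simp add: h3_def)
    also have "\<dots> = h1 y (min y' N)" using f2N[of y y'] yN(2) lt by simp
    also have "min y' N = N" using N1(1) y'(1) by simp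
    \<comment> \<open>\<open>y'\<close> lies where the temporary limit of \<open>y\<close> was in
      force.\<close>
    also have "h1 y N = (\<not> v)" using that by (simp add: h1_def s_def)
    finally show "h3 y y' \<noteq> v" by simp
  qed
  ultimately show ?thesis using b(1) by blast
qed

text \<open>In this cylinder every guard has limit \<open>v\<close>, so each added element has limit
  \<open>c\<close> and the extension to \<open>D\<close> is a genuine one for
  \<open>f\<close>.\<close>

lemma state_lim:
  assumes S: "state a0 y D h N" and f: "f \<in> B" "f \<in> cyl h N"
  shows "f \<in> cyl g0 N0 \<and> has_lim f y v \<and> steps c (val i f) E D"
proof -
  note S' = S[unfolded state_def]
  have yN: "N0 \<le> y" "y < N" and h: "h \<in> cyl g0 N0" "h y N = v" using S' by auto
  have fg: "f \<in> cyl g0 N0" using cyl_trans[OF h(1) _ f(2)] yN by simp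
  have "has_lim (val i f) x c" if x: "x \<in> D - E" for x
  proof -
    obtain w where w: "w < N" "h w N = v" "guard w x" using S' x by blast
    have "has_lim f w v" using cyl_has_lim[OF f(2) w(1)] w(2) by simp
    then show ?thesis using w(3) f(1) fg unfolding guard_def by blast
  qed
  then have "steps c (val i f) E D" using S' f(1) fg cyl_agree[OF f(2)] by blast
  moreover have "has_lim f y v" using cyl_has_lim[OF f(2) yN(2)] h(2) by simp
  ultimately show ?thesis using fg by blast
qed

text \<open>Repeating \<open>advance\<close> follows the bar for \<open>soon j p\<close>, so an
  output \<open>y'\<close> with \<open>f y y' \<noteq> v\<close> must turn up. But
  \<open>bad_lim\<close> yields \<open>v = d\<close>, and badness yields
  \<open>f y y' = d\<close>.\<close>

lemma no_state:
  assumes p: "even (card E) = p" and "soon j p D" "state a0 y D h N"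
  shows False
  using assms(2,3)
proof (induction arbitrary: h N)
  case (jbarI D)
  obtain b h' N' where IH: "new j D b \<and> even (card D) = p \<or> soon j p (insert b D) \<and> (\<forall>h N. \<not> state a0 y (insert b D) h N)"
    and S: "state a0 y (insert b D) h' N'"
    and out: "new j D b \<and> even (card D) = p \<longrightarrow> (\<exists>y'. P j (insert b D) y' \<and> y < y' \<and> y' < N' \<and> h' y y' \<noteq> v)"
    using advance[OF jbarI.prems p jbarI.IH] by blast
  have "new j D b \<and> even (card D) = p" using IH S by blast
  then obtain y' where y': "P j (insert b D) y'" "y < y'" "y' < N'" "h' y y' \<noteq> v" using out by blast
  note S' = S[unfolded state_def]
  have h': "h' \<in> cyl g0 N0" "N0 \<le> N'" "P j (insert b D) y" using S' by auto
  obtain f where f: "f \<in> B" "f \<in> cyl h' N'" using dense[OF h'(2,1)] by blast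
  have fl: "has_lim f y v" and fs: "steps c (val i f) E (insert b D)" using state_lim[OF S f] by auto
  have "v = d" using bad_lim[OF bad[OF f(1)] fs h'(3) fl] .
  moreover have "f y y' = d" using bad[OF f(1)] fs h'(3) y'(1,2) unfolding bad_def by blast
  moreover have "f y y' = h' y y'" using cyl_agree[OF f(2)] y'(2,3) unfolding agree_def by blast
  ultimately show False using y'(4) by simp
qed

text \<open>At the critical stage, a large \<open>a\<close> causes an output \<open>y\<close> and
  leaves a second output of the same parity unavoidable; this \<open>a\<close> serves as
  \<open>a0\<close> in a first state.\<close>

lemma contradiction: False
proof -
  obtain f where f: "f \<in> B" using dense[OF order_refl cyl_retract] by blast
  have cr: "crit j p E" and finE: "finite E" using bad[OF f] steps_finite_alternating unfolding bad_def by blast+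
  have p: "even (card E) = p" and ev: "\<forall>\<^sub>F a in tail X. new j E a" and fr: "\<exists>\<^sub>F a in tail X. soon j p (insert a E)"
    using cr unfolding crit_def by auto
  have "\<forall>\<^sub>F a in tail X. new j E a \<and> ok E a \<and> N0 \<le> a \<and> (\<exists>w\<ge>N0. guard w a) \<and>
      (new j E a \<longrightarrow> (\<exists>y\<ge>N0. P j (insert a E) y \<and> \<not> P j E y))"
    by (intro eventually_conj ev eventually_ok new_large eventually_guard eventually_tail_ge finE)
  from frequently_ex[OF frequently_eventually_frequently[OF fr this]] obtain a w y where
    a: "soon j p (insert a E)" "ok E a" "N0 \<le> a" and w: "N0 \<le> w" "guard w a"
    and y: "N0 \<le> y" "P j (insert a E) y" by blast
  define N where "N = Suc (max (max a w) y)"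
  \<comment> \<open>With limit \<open>v\<close> for all numbers from \<open>N0\<close> on, both
    \<open>y\<close> and the guard of \<open>a\<close> are right, even if they coincide.\<close>
  define h where "h x z = (if N0 \<le> x then v else g0 x (min z N0))" for x z
  have Ea: "x < a" if "x \<in> E" for x using E_less[OF that] a(3) by simp
  have "state a y (insert a E) h N"
    unfolding state_def
  proof (intro conjI)
    show "h \<in> cyl g0 N0" by (simp add: cyl_def h_def)
    show "h y N = v" using y by (simp add: h_def)
    show "\<forall>x\<in>insert a E. x < N" using Ea by (fastforce simp: N_def)
    show "insert a E \<inter> {..<a} = E" using Ea by auto
    have "w < N" by (simp add: N_def)
    then show "\<forall>x\<in>insert a E - E. \<exists>w<N. h w N = v \<and> (x \<noteq> a \<longrightarrow> w \<noteq> y) \<and> guard w x"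
      using w by (intro ballI exI[of _ w]) (auto simp: h_def)
    show "\<forall>f\<in>B. f \<in> cyl g0 N0 \<longrightarrow> agree N f h \<longrightarrow> (\<forall>x\<in>insert a E - E. has_lim (val i f) x c) \<longrightarrow>
        steps c (val i f) E (insert a E)"
    proof (intro ballI impI)
      fix f assume "f \<in> B" "f \<in> cyl g0 N0" "\<forall>x\<in>insert a E - E. has_lim (val i f) x c"
      then have "step c (val i f) E (insert a E)"
        unfolding step_def using a(2,3) E_lim Ea[of a] by (intro exI[of _ a]) auto
      then show "steps c (val i f) E (insert a E)" by (rule r_into_rtranclp)
    qed
  qed (use y finE in \<open>auto simp: N_def\<close>)
  then show False using no_state[OF p a(1)] by blast
qed

end

section \<open>Meeting all requirements\<close>

lemma generic_exists_countable:
  assumes "countable A" "\<forall>D\<in>A. dense_cyl D"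
  shows "\<exists>f. (\<forall>n. \<exists>g N. n \<le> N \<and> f \<in> cyl g N) \<and> (\<forall>D\<in>A. \<exists>g N. f \<in> cyl g N \<and> D g N)"
proof (cases "A = {}")
  case True
  then show ?thesis using generic_exists[of "\<lambda>_ _ _. True"] cyl_retract unfolding dense_cyl_def by blast
next
  case False
  have "dense_cyl (from_nat_into A n)" for n using assms(2) from_nat_into[OF False] by blast
  then obtain f where f: "\<forall>n. \<exists>g N. n \<le> N \<and> f \<in> cyl g N \<and> from_nat_into A n g N"
    using generic_exists[of "from_nat_into A"] by blast
  have "\<exists>g N. f \<in> cyl g N \<and> D g N" if D: "D \<in> A" for D
  proof -
    obtain n where "from_nat_into A n = D" using from_nat_into_surj[OF assms(1) D] by blast
    then show ?thesis using f[rule_format, of n] by blast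
  qed
  then show ?thesis using f by blast
qed

context thinned
begin

text \<open>If \<open>B\<close> were dense in a cylinder, some \<open>f\<close> in \<open>B\<close>
  there, cut at a length past the moduli for \<open>E\<close> and for the guards, would give a
  \<open>bad_region\<close>.\<close>

lemma nowhere_dense:
  assumes B: "\<And>f. f \<in> B \<Longrightarrow> generic f \<and> tot i f \<and> bad c f (val i f) j d p E"
    and guarded: "\<And>f. f \<in> B \<Longrightarrow> \<exists>M. \<forall>N\<ge>M. f \<in> cyl f N \<longrightarrow> (\<forall>n. \<forall>\<^sub>F a in tail X. \<exists>w\<ge>n. \<forall>h\<in>B.
      h \<in> cyl f N \<longrightarrow> has_lim h w v \<longrightarrow> has_lim (val i h) a c)"
  shows "dense_cyl (\<lambda>g N. cyl g N \<inter> B = {})"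
proof (rule ccontr)
  assume "\<not> ?thesis"
  then obtain g0 N0 where dense: "\<forall>g N. N0 \<le> N \<and> g \<in> cyl g0 N0 \<longrightarrow> cyl g N \<inter> B \<noteq> {}"
    unfolding dense_cyl_def by blast
  then obtain f where f: "f \<in> B" "f \<in> cyl (\<lambda>x z. g0 x (min z N0)) N0" using cyl_retract by blast
  have fg: "f \<in> cyl g0 N0" using f(2) cyl_eq[OF cyl_retract] by blast
  have gen: "generic f" "tot i f" and st: "steps c (val i f) {} E" using B[OF f(1)] unfolding bad_def by blast+
  have cE: "finite E" "\<forall>x\<in>E. has_lim (val i f) x c" using steps_cnd[OF st cnd_empty] unfolding cnd_def by auto
  obtain M1 where M1: "\<forall>N\<ge>M1. f \<in> cyl f N \<longrightarrow>
      (\<forall>h\<in>cyl f N. tot i h \<longrightarrow> (\<forall>x\<in>E. \<forall>u\<ge>N. x < u \<longrightarrow> val i h x u = c))"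
    using uniform_modulus[OF gen cE] by blast
  obtain M2 where M2: "\<forall>N\<ge>M2. f \<in> cyl f N \<longrightarrow> (\<forall>n. \<forall>\<^sub>F a in tail X. \<exists>w\<ge>n. \<forall>h\<in>B.
      h \<in> cyl f N \<longrightarrow> has_lim h w v \<longrightarrow> has_lim (val i h) a c)"
    using guarded[OF f(1)] by (elim exE)
  obtain k where k: "\<forall>x\<in>E. x < k" using cE(1) finite_nat_set_iff_bounded by auto
  obtain N where "max (max N0 k) (max M1 M2) \<le> N" and fN: "f \<in> cyl f N" using gen(1) unfolding generic_def by blast
  then have N: "N0 \<le> N" "k \<le> N" "M1 \<le> N" "M2 \<le> N" by auto
  have "bad_region Phi Psi Y X i B f N c d p v j E"
  proof (unfold_locales, goal_cases)
    case (3 N' h)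
    have "h \<in> cyl g0 N0" using cyl_trans[OF fg N(1) 3(2)] .
    moreover have "N0 \<le> N'" using N(1) 3(1) by simp
    ultimately show ?case using dense by blast
  next
    case (5 f' x u)
    have "x < u" using k 5(3,4) N(2) by fastforce
    then show ?case using M1 N(3) fN 5 B by blast
  next
    case (6 x)
    then show ?case using k N(2) by fastforce
  next
    case (7 n)
    show ?case using M2 N(4) fN by blast
  qed (use B in blast)+
  then show False by (rule bad_region.contradiction)
qed

text \<open>If almost all of \<open>X\<close> has limit \<open>c\<close>, any number is a
  guard.\<close>

lemma nowhere_dense_one:
  "dense_cyl (\<lambda>g N. cyl g N \<inter> {f. generic f \<and> tot i f \<and> bad c f (val i f) j d p E \<and>
     (\<forall>a\<in>X. k \<le> a \<longrightarrow> has_lim (val i f) a c)} = {})"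
proof (rule nowhere_dense[where v = True and i = i and c = c and j = j and d = d and p = p and E = E], goal_cases)
  case (2 f)
  have ev: "\<forall>\<^sub>F a in tail X. k \<le> a \<and> a \<in> X"
    by (intro eventually_conj eventually_tail_ge eventually_tail_mem)
  show ?case
    by (intro exI[of _ 0] allI impI, rule eventually_mono[OF ev]) blast
qed blast

text \<open>Badness for \<open>True\<close> supplies guards for \<open>False\<close>. If
  \<open>a\<close> had limit \<open>True\<close>, it would extend \<open>E'\<close>, and by
  \<open>bad_lim\<close> the output \<open>w\<close> it causes would have limit \<open>d'\<close>;
  so limit \<open>\<not> d'\<close> for \<open>w\<close> forces \<open>a\<close> to have limit
  \<open>False\<close>.\<close>

lemma nowhere_dense_two:
  "dense_cyl (\<lambda>g N. cyl g N \<inter> {f. generic f \<and> tot i f \<and> stable (val i f) \<and>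
     bad False f (val i f) j d p E \<and> bad True f (val i f) j' d' p' E'} = {})" (is "dense_cyl (\<lambda>g N. cyl g N \<inter> ?B = {})")
proof (rule nowhere_dense[where v = "\<not> d'" and i = i and c = False and j = j and d = d and p = p and E = E], goal_cases)
  case (2 f)
  have gen: "generic f" "tot i f" and st: "steps True (val i f) {} E'" using 2 unfolding bad_def by blast+
  have cE: "finite E'" "\<forall>x\<in>E'. has_lim (val i f) x True" using steps_cnd[OF st cnd_empty] unfolding cnd_def by auto
  obtain M where M: "\<forall>N\<ge>M. f \<in> cyl f N \<longrightarrow>
      (\<forall>h\<in>cyl f N. tot i h \<longrightarrow> (\<forall>x\<in>E'. \<forall>u\<ge>N. x < u \<longrightarrow> val i h x u = True))"
    using uniform_modulus[OF gen cE] by (elim exE)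
  have new: "\<forall>\<^sub>F a in tail X. new j' E' a" using 2 unfolding bad_def crit_def by blast
  show ?case
  proof (intro exI[of _ M] allI impI)
    fix N n assume N: "M \<le> N" "f \<in> cyl f N"
    have "\<forall>\<^sub>F a in tail X. new j' E' a \<and> ok E' a \<and> N \<le> a \<and>
        (new j' E' a \<longrightarrow> (\<exists>w\<ge>n. P j' (insert a E') w \<and> \<not> P j' E' w))"
      by (intro eventually_conj new eventually_ok eventually_tail_ge new_large cE(1))
    then show "\<forall>\<^sub>F a in tail X. \<exists>w\<ge>n. \<forall>h\<in>?B. h \<in> cyl f N \<longrightarrow> has_lim h w (\<not> d') \<longrightarrow> has_lim (val i h) a False"
    proof (rule eventually_mono)
      fix a assume "new j' E' a \<and> ok E' a \<and> N \<le> a \<and>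
        (new j' E' a \<longrightarrow> (\<exists>w\<ge>n. P j' (insert a E') w \<and> \<not> P j' E' w))"
      then obtain w where a: "ok E' a" "N \<le> a" and w: "n \<le> w" "P j' (insert a E') w" by blast
      have "has_lim (val i h) a False" if h: "h \<in> ?B" "h \<in> cyl f N" "has_lim h w (\<not> d')" for h
      proof (rule ccontr)
        assume no: "\<not> has_lim (val i h) a False"
        have hB: "tot i h" "stable (val i h)" and bad: "bad True h (val i h) j' d' p' E'" using h(1) by blast+
        obtain b where b: "has_lim (val i h) a b" using hB(2) unfolding stable_has_lim by blast
        have lim: "has_lim (val i h) a True" using b no by (cases b) auto
        have "\<forall>x\<in>E'. x < a" using a(1) unfolding ok_def by blast
        \<comment> \<open>The modulus found for \<open>f\<close> holds throughout its cylinder,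
          which makes \<open>a\<close> compatible with \<open>E'\<close> for every such
          \<open>h\<close>.\<close>
        then have "\<forall>x\<in>E'. val i h x a = True" using M N h(2) hB(1) a(2) by blast
        then have "step True (val i h) E' (insert a E')"
          unfolding step_def using a(1) lim by (intro exI[of _ a]) simp
        then have "steps True (val i h) E' (insert a E')" by (rule r_into_rtranclp)
        from bad_lim[OF bad this w(2) h(3)] show False by simp
      qed
      then show "\<exists>w\<ge>n. \<forall>h\<in>?B. h \<in> cyl f N \<longrightarrow> has_lim h w (\<not> d') \<longrightarrow> has_lim (val i h) a False"
        using w(1) by blast
    qed
  qed
qed blast

lemma bad_decode: "bad c f g j d p E \<Longrightarrow> set_decode (set_encode E) = E"
  using steps_finite_alternating unfolding bad_def by (intro set_encode_inverse) blast

text \<open>If both colors occur as limits infinitely often on \<open>X\<close>, both constructions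
  fail and \<open>two\<close> applies. Otherwise stability gives almost all of \<open>X\<close> one
  limit, and \<open>one\<close> applies.\<close>

lemma generic_solves:
  assumes gen: "generic f"
    and inh: "\<And>j E. finite E \<Longrightarrow> infinite {y. P j E y} \<Longrightarrow> inhom f {y. P j E y}"
    and one: "\<And>i c j d p E k. \<not> (generic f \<and> tot i f \<and> bad c f (val i f) j d p E \<and>
       (\<forall>a\<in>X. k \<le> a \<longrightarrow> has_lim (val i f) a c))"
    and two: "\<And>i j d p E j' d' p' E'. \<not> (generic f \<and> tot i f \<and> stable (val i f) \<and>
       bad False f (val i f) j d p E \<and> bad True f (val i f) j' d' p' E')"
    and st: "stable (val i f)" and tot: "tot i f"
  shows "\<exists>c Z. infinite Z \<and> alternating c (val i f) Z \<and> (\<forall>j. \<not> homogeneous f {y. Psi j Z y})"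
proof (rule ccontr)
  assume no: "\<not> ?thesis"
  have bad: "\<exists>j d p E. bad c f (val i f) j d p E" if "\<exists>\<^sub>F a in tail X. has_lim (val i f) a c" for c
    using build_or_bad[OF that inh] no by blast
  show False
  proof (cases "\<forall>c. \<exists>\<^sub>F a in tail X. has_lim (val i f) a c")
    case True
    then obtain j d p E j' d' p' E' where "bad False f (val i f) j d p E" "bad True f (val i f) j' d' p' E'"
      using bad by meson
    then show False using two gen tot st by blast
  next
    case False
    then obtain c' where c': "\<not> (\<exists>\<^sub>F a in tail X. has_lim (val i f) a c')" by (elim not_all[THEN iffD1, THEN exE])
    define c where "c = (\<not> c')"
    have "\<forall>\<^sub>F a in tail X. \<not> has_lim (val i f) a (\<not> c)"
      using c' unfolding frequently_def c_def by simp
    then have ev: "\<forall>\<^sub>F a in tail X. has_lim (val i f) a c"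
    proof (rule eventually_mono)
      fix a assume a: "\<not> has_lim (val i f) a (\<not> c)"
      obtain b where "has_lim (val i f) a b" using st unfolding stable_has_lim by blast
      then show "has_lim (val i f) a c" using a by (cases b; cases c) auto
    qed
    obtain k where k: "\<forall>a\<in>X. k \<le> a \<longrightarrow> has_lim (val i f) a c" using ev unfolding eventually_tail by blast
    have "\<exists>\<^sub>F a in tail X. has_lim (val i f) a c"
      using ev tail_neq_bot[OF X_inf] by (rule eventually_frequently[rotated])
    then obtain j d p E where "bad c f (val i f) j d p E" using bad by blast
    then show False using one gen tot k by blast
  qed
qed

text \<open>Failures start from finite sets, so coding these by numbers leaves countably many dense
  requirements.\<close>

lemma exists_generic:
  "\<exists>f. generic f \<and> (\<forall>j E. finite E \<longrightarrow> infinite {y. P j E y} \<longrightarrow> inhom f {y. P j E y}) \<and>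
    (\<forall>i c j d p E k. \<not> (generic f \<and> tot i f \<and> bad c f (val i f) j d p E \<and>
       (\<forall>a\<in>X. k \<le> a \<longrightarrow> has_lim (val i f) a c))) \<and>
    (\<forall>i j d p E j' d' p' E'. \<not> (generic f \<and> tot i f \<and> stable (val i f) \<and>
       bad False f (val i f) j d p E \<and> bad True f (val i f) j' d' p' E'))"
proof -
  define A1 where "A1 = range (\<lambda>(i, a, m, c). decides i a m c)"
  define S where "S j e = {y. P j (set_decode e) y}" for j e
  define A2 where "A2 = range (\<lambda>(j, e). \<lambda>g N. infinite (S j e) \<longrightarrow> (\<forall>h\<in>cyl g N. inhom h (S j e)))"
  define B1 where "B1 i c j d p e k = {f. generic f \<and> tot i f \<and>
      bad c f (val i f) j d p (set_decode e) \<and> (\<forall>a\<in>X. k \<le> a \<longrightarrow> has_lim (val i f) a c)}" for i c j d p e k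
  define A3 where "A3 = range (\<lambda>(i, c, j, d, p, e, k). \<lambda>g N. cyl g N \<inter> B1 i c j d p e k = {})"
  define B2 where "B2 i j d p e j' d' p' e' = {f. generic f \<and> tot i f \<and> stable (val i f) \<and>
      bad False f (val i f) j d p (set_decode e) \<and> bad True f (val i f) j' d' p' (set_decode e')}" for i j d p e j' d' p' e'
  define A4 where "A4 = range (\<lambda>(i, j, d, p, e, j', d', p', e'). \<lambda>g N. cyl g N \<inter> B2 i j d p e j' d' p' e' = {})"
  have cnt: "countable (A1 \<union> A2 \<union> A3 \<union> A4)"
    unfolding A1_def A2_def A3_def A4_def by (intro countable_Un countable_image countableI_type)
  have "dense_cyl (\<lambda>g N. infinite (S j e) \<longrightarrow> (\<forall>h\<in>cyl g N. inhom h (S j e)))" for j e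
  proof (cases "infinite (S j e)")
    case True
    then show ?thesis using dense_inhom by simp
  next
    case False
    then show ?thesis unfolding dense_cyl_def using cyl_retract by auto
  qed
  then have "\<forall>D\<in>A1 \<union> A2 \<union> A3 \<union> A4. dense_cyl D"
    using dense_decides nowhere_dense_one nowhere_dense_two
    unfolding A1_def A2_def A3_def A4_def B1_def B2_def by auto
  from generic_exists_countable[OF cnt this] obtain f where
    fN: "\<forall>n. \<exists>g N. n \<le> N \<and> f \<in> cyl g N" and
    meets: "\<forall>D\<in>A1 \<union> A2 \<union> A3 \<union> A4. \<exists>g N. f \<in> cyl g N \<and> D g N" by (elim exE conjE)
  have m1: "\<exists>g N. f \<in> cyl g N \<and> D g N" if "D \<in> A1" for D using meets that by blast
  have m2: "\<exists>g N. f \<in> cyl g N \<and> D g N" if "D \<in> A2" for D using meets that by blast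
  have m3: "\<exists>g N. f \<in> cyl g N \<and> D g N" if "D \<in> A3" for D using meets that by blast
  have m4: "\<exists>g N. f \<in> cyl g N \<and> D g N" if "D \<in> A4" for D using meets that by blast
  have gen: "generic f"
  proof (rule genericI)
    show "\<exists>g N. n \<le> N \<and> f \<in> cyl g N" for n using fN by blast
    fix i a m c
    have "decides i a m c \<in> A1" unfolding A1_def by (rule range_eqI[of _ _ "(i, a, m, c)"]) simp
    then show "\<exists>g N. f \<in> cyl g N \<and> decides i a m c g N" by (rule m1)
  qed
  moreover have "inhom f {y. P j E y}" if "finite E" "infinite {y. P j E y}" for j E
  proof -
    have S: "S j (set_encode E) = {y. P j E y}" using that(1) by (simp add: S_def)
    have "(\<lambda>g N. infinite (S j (set_encode E)) \<longrightarrow> (\<forall>h\<in>cyl g N. inhom h (S j (set_encode E)))) \<in> A2"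
      unfolding A2_def by (rule range_eqI[of _ _ "(j, set_encode E)"]) simp
    then have "\<exists>g N. f \<in> cyl g N \<and> (infinite (S j (set_encode E)) \<longrightarrow> (\<forall>h\<in>cyl g N. inhom h (S j (set_encode E))))"
      by (rule m2)
    then show ?thesis using that(2) unfolding S by blast
  qed
  moreover have "\<not> (generic f \<and> tot i f \<and> bad c f (val i f) j d p E \<and>
       (\<forall>a\<in>X. k \<le> a \<longrightarrow> has_lim (val i f) a c))" (is "\<not> ?bad") for i c j d p E k
  proof
    assume h: ?bad
    then have "set_decode (set_encode E) = E" using bad_decode by blast
    then have "f \<in> B1 i c j d p (set_encode E) k" using h unfolding B1_def by simp
    moreover have "(\<lambda>g N. cyl g N \<inter> B1 i c j d p (set_encode E) k = {}) \<in> A3"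
      unfolding A3_def by (rule range_eqI[of _ _ "(i, c, j, d, p, set_encode E, k)"]) simp
    then have "\<exists>g N. f \<in> cyl g N \<and> cyl g N \<inter> B1 i c j d p (set_encode E) k = {}" by (rule m3)
    ultimately show False by blast
  qed
  moreover have "\<not> (generic f \<and> tot i f \<and> stable (val i f) \<and>
       bad False f (val i f) j d p E \<and> bad True f (val i f) j' d' p' E')" (is "\<not> ?bad") for i j d p E j' d' p' E'
  proof
    assume h: ?bad
    then have "set_decode (set_encode E) = E" "set_decode (set_encode E') = E'" using bad_decode by blast+
    then have "f \<in> B2 i j d p (set_encode E) j' d' p' (set_encode E')" using h unfolding B2_def by simp
    moreover have "(\<lambda>g N. cyl g N \<inter> B2 i j d p (set_encode E) j' d' p' (set_encode E') = {}) \<in> A4"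
      unfolding A4_def by (rule range_eqI[of _ _ "(i, j, d, p, set_encode E, j', d', p', set_encode E')"]) simp
    then have "\<exists>g N. f \<in> cyl g N \<and> cyl g N \<inter> B2 i j d p (set_encode E) j' d' p' (set_encode E') = {}"
      by (rule m4)
    ultimately show False by blast
  qed
  ultimately show ?thesis by blast
qed

end

context functionals
begin

text \<open>Three thinnings in order: \<open>Y\<close> for promises, \<open>X0\<close> for
  cohesiveness of new outputs, \<open>X\<close> for bars of new outputs. Cohesiveness passes down to
  \<open>X\<close>.\<close>

lemma thinned_exists: "\<exists>Y X. thinned Phi Psi Y X"
proof -
  obtain Y where Y: "infinite Y" and dY: "\<forall>n E. finite E \<longrightarrow>
      jbar Y (\<lambda>E a. settled (fst (prod_decode n)) (insert a E) (snd (prod_decode n))) E \<or>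
      (\<forall>\<^sub>F a in tail Y. \<not> settled (fst (prod_decode n)) (insert a E) (snd (prod_decode n)) \<and>
        \<not> jbar Y (\<lambda>E a. settled (fst (prod_decode n)) (insert a E) (snd (prod_decode n))) (insert a E))"
    using thin_jbar[OF infinite_UNIV_nat, of "\<lambda>n E a. settled (fst (prod_decode n)) (insert a E) (snd (prod_decode n))"]
    by (elim exE conjE)
  obtain X0 where X0: "X0 \<subseteq> Y" "infinite X0" and dX0: "\<forall>n E. finite E \<longrightarrow>
      (\<forall>\<^sub>F a in tail X0. fresh Y n E a) \<or> (\<forall>\<^sub>F a in tail X0. \<not> fresh Y n E a)"
    using thin_cohesive[OF Y, of "fresh Y"] by (elim exE conjE)
  let ?B = "\<lambda>n E a. fresh Y (fst (prod_decode n)) E a \<and> even (card E) = (snd (prod_decode n) = 0)"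
  obtain X where X: "X \<subseteq> X0" "infinite X" and dX: "\<forall>n E. finite E \<longrightarrow> jbar X (?B n) E \<or>
      (\<forall>\<^sub>F a in tail X. \<not> ?B n E a \<and> \<not> jbar X (?B n) (insert a E))"
    using thin_jbar[OF X0(2), of ?B] by (elim exE conjE)
  have le: "tail X \<le> tail X0" using X(1) by (intro tail_mono) (simp add: Diff_eq_empty_iff[THEN iffD2])
  have "thinned Phi Psi Y X"
  proof (unfold_locales, goal_cases)
    case 1
    show ?case using X(1) X0(1) by blast
  next
    case 2
    show ?case by (rule X(2))
  next
    case (3 E j y)
    then show ?case using dY[rule_format, of E "prod_encode (j, y)"] by simp
  next
    case (4 E j p)
    then show ?case using dX[rule_format, of E "prod_encode (j, if p then 0 else 1)"] by (cases p) simp_all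
  next
    case (5 E j)
    then show ?case using dX0[rule_format, of E j] filter_leD[OF le] by blast
  qed
  then show ?thesis by blast
qed

theorem generic_coloring:
  "\<exists>f. stable f \<and> (\<forall>i g. stable g \<and> (\<forall>a u. a < u \<longrightarrow> Phi i f a u (g a u)) \<longrightarrow>
    (\<exists>c Z. infinite Z \<and> alternating c g Z \<and> (\<forall>j. \<not> homogeneous f {y. Psi j Z y})))"
proof -
  obtain Y X where "thinned Phi Psi Y X" using thinned_exists by blast
  then interpret thinned Phi Psi Y X .
  obtain f where gen: "generic f" and
    f: "\<forall>j E. finite E \<longrightarrow> infinite {y. P j E y} \<longrightarrow> inhom f {y. P j E y}"
    "\<forall>i c j d p E k. \<not> (generic f \<and> tot i f \<and> bad c f (val i f) j d p E \<and>
       (\<forall>a\<in>X. k \<le> a \<longrightarrow> has_lim (val i f) a c))"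
    "\<forall>i j d p E j' d' p' E'. \<not> (generic f \<and> tot i f \<and> stable (val i f) \<and>
       bad False f (val i f) j d p E \<and> bad True f (val i f) j' d' p' E')"
    using exists_generic by (elim exE conjE)
  have "\<exists>c Z. infinite Z \<and> alternating c g Z \<and> (\<forall>j. \<not> homogeneous f {y. Psi j Z y})"
    if g: "stable g" "\<forall>a u. a < u \<longrightarrow> Phi i f a u (g a u)" for i g
  proof -
    have tot: "tot i f" using g(2) unfolding tot_def by blast
    have vg: "val i f a u = g a u" if "a < u" for a u using val_eqI g(2) that by blast
    then have "stable (val i f)" using g(1) unfolding stable_def by auto
    from generic_solves[OF gen f(1)[rule_format] f(2)[rule_format] f(3)[rule_format] this tot]
    obtain c Z where Z: "infinite Z" "alternating c (val i f) Z" "\<forall>j. \<not> homogeneous f {y. Psi j Z y}" by blast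
    have "alternating c g Z" using Z(2) vg unfolding alternating_def by auto
    then show ?thesis using Z by blast
  qed
  then show ?thesis using generic_stable[OF gen] by blast
qed

end

subsection \<open>Oracle computations\<close>

instance rprog :: countable
  by countable_datatype

lemma list_all2_uniform:
  assumes "list_all2 (\<lambda>x y. \<exists>k::nat. R k x y) xs ys" "\<And>k k' x y. R k x y \<Longrightarrow> k \<le> k' \<Longrightarrow> R k' x y"
  shows "\<exists>k. list_all2 (R k) xs ys"
  using assms(1)
proof (induction rule: list_all2_induct)
  case (Cons x xs y ys)
  then obtain k1 k2 where k: "R k1 x y" "list_all2 (R k2) xs ys" by blast
  have "R (max k1 k2) x y" using assms(2)[OF k(1)] by simp
  moreover have "list_all2 (R (max k1 k2)) xs ys"
    using k(2) by (rule list_all2_mono) (erule assms(2), simp)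
  ultimately show ?case by (intro exI[of _ "max k1 k2"]) simp
qed simp

text \<open>The use principle: a derivation asks finitely many oracle questions, and bounds for
  subderivations combine by maxima.\<close>

lemma reval_use:
  assumes "reval A p xs v"
  shows "\<exists>k. \<forall>A'. A' \<inter> {..<k} = A \<inter> {..<k} \<longrightarrow> reval A' p xs v"
proof -
  define loc where "loc k A' \<longleftrightarrow> (\<forall>x<k. x \<in> A' \<longleftrightarrow> x \<in> A)" for k :: nat and A'
  have loc_mono: "loc k A'" if "loc k' A'" "k \<le> k'" for k k' A'
    using that unfolding loc_def by (meson less_le_trans)
  have loc_max: "loc (max k k') A' \<Longrightarrow> loc k A' \<and> loc k' A'" for k k' A'
    unfolding loc_def by simp
  have "\<exists>k. \<forall>A'. loc k A' \<longrightarrow> reval A' p xs v"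
    using assms
  proof induction
    case (orac x xs)
    have "reval A' Oracle (x # xs) (if x \<in> A then 1 else 0)" if "loc (Suc x) A'" for A'
    proof -
      have "x \<in> A' \<longleftrightarrow> x \<in> A" using that unfolding loc_def by simp
      then show ?thesis using reval.orac[of A' x xs] by simp
    qed
    then show ?case by blast
  next
    case (comp xs gs ys f v)
    obtain k1 where k1: "\<forall>A'. loc k1 A' \<longrightarrow> reval A' f ys v" using comp by blast
    have "list_all2 (\<lambda>g y. \<exists>k. \<forall>A'. loc k A' \<longrightarrow> reval A' g xs y) gs ys"
      using comp(1) by (rule list_all2_mono) blast
    then have "\<exists>k. list_all2 (\<lambda>g y. \<forall>A'. loc k A' \<longrightarrow> reval A' g xs y) gs ys"
      by (rule list_all2_uniform) (use loc_mono in blast)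
    then obtain k2 where k2: "list_all2 (\<lambda>g y. \<forall>A'. loc k2 A' \<longrightarrow> reval A' g xs y) gs ys" by blast
    have "reval A' (Comp f gs) xs v" if "loc (max k1 k2) A'" for A'
    proof (rule reval.comp)
      show "list_all2 (\<lambda>g y. reval A' g xs y) gs ys"
        using k2 by (rule list_all2_mono) (use loc_max[OF that] in blast)
      show "reval A' f ys v" using k1 loc_max[OF that] by blast
    qed
    then show ?case by blast
  next
    case (precS f g n xs u v)
    then obtain k1 k2 where k: "\<forall>A'. loc k1 A' \<longrightarrow> reval A' (Prec f g) (n # xs) u"
      "\<forall>A'. loc k2 A' \<longrightarrow> reval A' g (n # u # xs) v" by blast
    have "reval A' (Prec f g) (Suc n # xs) v" if "loc (max k1 k2) A'" for A'
      using k loc_max[OF that] by (blast intro: reval.precS)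
    then show ?case by blast
  next
    case (mn f n xs)
    obtain k1 where k1: "\<forall>A'. loc k1 A' \<longrightarrow> reval A' f (n # xs) 0" using mn by blast
    have "\<forall>m\<in>{..<n}. \<exists>k v. \<forall>A'. loc k A' \<longrightarrow> reval A' f (m # xs) (Suc v)" using mn by blast
    then obtain K where K: "\<forall>m\<in>{..<n}. \<exists>v. \<forall>A'. loc (K m) A' \<longrightarrow> reval A' f (m # xs) (Suc v)" by metis
    obtain k2 where k2: "\<forall>m\<in>{..<n}. K m < k2" using finite_nat_set_iff_bounded[of "K ` {..<n}"] by auto
    have "reval A' (Mn f) xs n" if "loc (max k1 k2) A'" for A'
    proof (rule reval.mn)
      show "reval A' f (n # xs) 0" using k1 loc_max[OF that] by blast
      show "\<forall>m<n. \<exists>v. reval A' f (m # xs) (Suc v)"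
      proof (intro allI impI)
        fix m assume "m < n"
        then have "loc (K m) A'" using loc_max[OF that] loc_mono[of k2 A' "K m"] k2 by (simp add: less_imp_le)
        then show "\<exists>v. reval A' f (m # xs) (Suc v)" using K \<open>m < n\<close> by blast
      qed
    qed
    then show ?case by blast
  qed (blast intro: reval.intros)+
  then obtain k where "\<forall>A'. loc k A' \<longrightarrow> reval A' p xs v" by blast
  moreover have "loc k A'" if "A' \<inter> {..<k} = A \<inter> {..<k}" for A'
    using that unfolding loc_def by blast
  ultimately show ?thesis by blast
qed

inductive_cases revalE:
  "reval A Zero xs v" "reval A Succ xs v" "reval A (Proj k) xs v" "reval A Oracle xs v"
  "reval A (Comp f gs) xs v" "reval A (Prec f g) (0 # xs) v" "reval A (Prec f g) (Suc n # xs) v"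
  "reval A (Mn f) xs v"

lemma reval_unique: "reval A p xs v \<Longrightarrow> reval A p xs v' \<Longrightarrow> v = v'"
proof (induction arbitrary: v' rule: reval.induct)
  case (comp xs gs ys f v)
  from comp.prems obtain ys' where ys': "list_all2 (\<lambda>g y. reval A g xs y) gs ys'" "reval A f ys' v'"
    by (rule revalE) blast
  have "ys = ys'"
    using comp.IH(1) ys'(1)
  proof (induction gs arbitrary: ys ys')
    case (Cons g gs)
    obtain y zs where 1: "ys = y # zs" "\<forall>v'. reval A g xs v' \<longrightarrow> y = v'"
      "list_all2 (\<lambda>g y. reval A g xs y \<and> (\<forall>v'. reval A g xs v' \<longrightarrow> y = v')) gs zs"
      using Cons.prems(1) unfolding list_all2_Cons1 by blast
    obtain y' zs' where 2: "ys' = y' # zs'" "reval A g xs y'" "list_all2 (\<lambda>g y. reval A g xs y) gs zs'"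
      using Cons.prems(2) unfolding list_all2_Cons1 by blast
    show ?case using 1 2 Cons.IH[OF 1(3) 2(3)] by simp
  qed simp
  then show ?case using comp ys'(2) by blast
next
  case (precS f g n xs u v)
  from precS.prems obtain u' where "reval A (Prec f g) (n # xs) u'" "reval A g (n # u' # xs) v'"
    by (rule revalE) blast
  then show ?case using precS.IH by blast
next
  case (mn f n xs)
  from mn.prems have n': "reval A f (v' # xs) 0" "\<forall>m<v'. \<exists>v. reval A f (m # xs) (Suc v)"
    by (elim revalE; simp)+
  have "\<not> n < v'" using mn.IH(1) n'(2) by fastforce
  moreover have "\<not> v' < n" using mn.IH(2) n'(1) by fastforce
  ultimately show ?case by simp
next
  case (zero xs)
  then show ?case by (rule revalE(1)) simp
next
  case (succ x xs)
  then show ?case by (rule revalE(2)) simp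
next
  case (proj i xs)
  from proj(2) show ?case by (rule revalE(3)) simp
next
  case (orac x xs)
  then show ?case by (rule revalE(4)) simp
next
  case (prec0 f xs v g)
  from prec0.prems show ?case by (rule revalE(6)) (rule prec0.IH)
qed

section \<open>Splitting a set by the parity of ranks\<close>

definition split_join :: "nat set \<Rightarrow> nat set" where
  "split_join Z = {z\<in>Z. even (card (Z \<inter> {..<z}))} \<oplus> {z\<in>Z. odd (card (Z \<inter> {..<z}))}"

text \<open>The rank of \<open>z\<close> depends only on the part of the set below \<open>z\<close>,
  and each element is at most its code in the join.\<close>

lemma split_join_local:
  assumes "Z' \<inter> {..<k} = Z \<inter> {..<k}"
  shows "split_join Z' \<inter> {..<k} = split_join Z \<inter> {..<k}"
proof -
  have mem: "z \<in> Z' \<longleftrightarrow> z \<in> Z" if "z < k" for z using assms that by (auto simp: set_eq_iff)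
  have rank: "Z' \<inter> {..<z} = Z \<inter> {..<z}" if "z < k" for z using mem that by auto
  have "w \<in> split_join Z' \<longleftrightarrow> w \<in> split_join Z" if "w < k" for w
  proof -
    have "z < k" if "w = 2 * z \<or> w = 2 * z + 1" for z using \<open>w < k\<close> that by auto
    then show ?thesis unfolding split_join_def join_def using mem rank by auto
  qed
  then show ?thesis by auto
qed

lemma col_set_local:
  assumes "agree k f g"
  shows "col_set g \<inter> {..<k} = col_set f \<inter> {..<k}"
proof -
  \<comment> \<open>The code of a pair is at least its larger member, so codes below
    \<open>k\<close> involve only numbers below \<open>k\<close>.\<close>
  have "f x y = g x y" if "prod_encode (x, y) < k" "x < y" for x y
    using assms that le_prod_encode_2[of y x] unfolding agree_def by (meson le_less_trans)
  then show ?thesis unfolding col_set_def by auto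
qed

text \<open>Programs are indexed through countability. For \<open>Psi\<close> it suffices to record
  the answer 1, because a decided set is exactly the set of inputs with that answer.\<close>

interpretation turing: functionals
  "\<lambda>i f a u c. reval (col_set f) (from_nat i) [prod_encode (a, u)] (if c then 1 else 0)"
  "\<lambda>j Z y. reval (split_join Z) (from_nat j) [y] 1"
proof (unfold_locales, goal_cases)
  case (1 i f a u c)
  obtain k where k: "\<forall>A'. A' \<inter> {..<k} = col_set f \<inter> {..<k} \<longrightarrow>
      reval A' (from_nat i) [prod_encode (a, u)] (if c then 1 else 0)"
    using reval_use[OF 1] by (elim exE)
  show ?case by (intro exI[of _ k] allI impI k[rule_format] col_set_local)
next
  case (2 i f a u c c')
  from reval_unique[OF 2] show ?case by (cases c; cases c') simp_all
next
  case (3 j Z y)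
  obtain k where k: "\<forall>A'. A' \<inter> {..<k} = split_join Z \<inter> {..<k} \<longrightarrow> reval A' (from_nat j) [y] 1"
    using reval_use[OF 3] by (elim exE)
  show ?case by (intro exI[of _ k] allI impI k[rule_format] split_join_local)
qed

text \<open>Consecutive elements have consecutive ranks, so past any \<open>n\<close> both parities
  occur.\<close>

lemma infinite_rank_parity:
  fixes Z :: "nat set"
  assumes "infinite Z"
  shows "infinite {z\<in>Z. even (card (Z \<inter> {..<z})) = p}"
  unfolding infinite_nat_iff_unbounded_le
proof
  fix n
  have nxt: "\<exists>z\<in>Z. m \<le> z \<and> Z \<inter> {m..<z} = {}" for m
  proof -
    have ex: "\<exists>z. z \<in> Z \<and> m \<le> z" using assms unfolding infinite_nat_iff_unbounded_le by blast
    define z where "z = (LEAST z. z \<in> Z \<and> m \<le> z)"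
    have "z \<in> Z \<and> m \<le> z" unfolding z_def using ex by (rule LeastI_ex)
    moreover have "Z \<inter> {m..<z} = {}" using not_less_Least unfolding z_def by fastforce
    ultimately show ?thesis by blast
  qed
  obtain z where z: "z \<in> Z" "n \<le> z" using nxt by blast
  obtain z' where z': "z' \<in> Z" "Suc z \<le> z'" "Z \<inter> {Suc z..<z'} = {}" using nxt by blast
  have "Z \<inter> {..<z'} = insert z (Z \<inter> {..<z})" 
  proof (intro set_eqI iffI)
    fix x assume x: "x \<in> Z \<inter> {..<z'}"
    then have "x \<notin> {Suc z..<z'}" using z'(3) by blast
    then show "x \<in> insert z (Z \<inter> {..<z})" using x by auto
  qed (use z z' in auto)
  then have "card (Z \<inter> {..<z'}) = Suc (card (Z \<inter> {..<z}))" by simp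
  then have "even (card (Z \<inter> {..<z'})) \<noteq> even (card (Z \<inter> {..<z}))" by simp
  then show "\<exists>x\<ge>n. x \<in> {z\<in>Z. even (card (Z \<inter> {..<z})) = p}"
    using z z' by (cases "even (card (Z \<inter> {..<z})) = p") (auto intro: exI[of _ z] exI[of _ z'])
qed

lemma alternating_p_homogeneous:
  assumes "infinite Z" "alternating c g Z"
  shows "p_homogeneous g (split_join Z)"
  unfolding p_homogeneous_def
proof (intro exI conjI)
  let ?L = "{z\<in>Z. even (card (Z \<inter> {..<z}))}" and ?R = "{z\<in>Z. odd (card (Z \<inter> {..<z}))}"
  show "infinite ?L" using infinite_rank_parity[OF assms(1), of True] by simp
  show "infinite ?R" using infinite_rank_parity[OF assms(1), of False] by simp
  show "split_join Z = ?L \<oplus> ?R" by (simp add: split_join_def)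
  show "\<forall>x\<in>?L. \<forall>y\<in>?R. x \<noteq> y \<longrightarrow> g (min x y) (max x y) = c"
  proof (intro ballI impI)
    fix x y assume "x \<in> ?L" "y \<in> ?R" "x \<noteq> y"
    then show "g (min x y) (max x y) = c"
      using assms(2) unfolding alternating_def by (cases "x < y") (auto simp: min_def max_def)
  qed
qed

theorem theorem3p1:
  shows "\<exists>(f :: nat \<Rightarrow> nat \<Rightarrow> bool) (Y :: nat set set).
    stable f \<and> (\<forall>P\<in>Y. infinite P) \<and>
    (\<forall>P\<in>Y. \<forall>H. H \<le>\<^sub>T (col_set f \<oplus> P) \<longrightarrow> \<not> homogeneous f H) \<and>
    (\<forall>f' :: nat \<Rightarrow> nat \<Rightarrow> bool. stable f' \<and> col_set f' \<le>\<^sub>T col_set f \<longrightarrow>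
       (\<exists>P\<in>Y. \<exists>H. H \<le>\<^sub>T (col_set f \<oplus> P) \<and> p_homogeneous f' H) \<or>
       (\<exists>H. p_homogeneous f' H \<and> (\<forall>K. K \<le>\<^sub>T H \<longrightarrow> \<not> homogeneous f K)))"
proof -
  obtain f where "stable f" and f: "\<forall>i g. stable g \<and>
      (\<forall>a u. a < u \<longrightarrow> reval (col_set f) (from_nat i) [prod_encode (a, u)] (if g a u then 1 else 0)) \<longrightarrow>
      (\<exists>c Z. infinite Z \<and> alternating c g Z \<and> (\<forall>j. \<not> homogeneous f {y. reval (split_join Z) (from_nat j) [y] 1}))"
    using turing.generic_coloring by (elim exE conjE)
  have "\<exists>H. p_homogeneous f' H \<and> (\<forall>K. K \<le>\<^sub>T H \<longrightarrow> \<not> homogeneous f K)"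
    if f': "stable f'" "col_set f' \<le>\<^sub>T col_set f" for f'
  proof -
    obtain q where q: "\<forall>x. reval (col_set f) q [x] (if x \<in> col_set f' then 1 else 0)"
      using f'(2) unfolding turing_le_def by blast
    have "reval (col_set f) (from_nat (to_nat q)) [prod_encode (a, u)] (if f' a u then 1 else 0)" if "a < u" for a u
    proof -
      have "prod_encode (a, u) \<in> col_set f' \<longleftrightarrow> f' a u" using that unfolding col_set_def by auto
      then show ?thesis using q[rule_format, of "prod_encode (a, u)"] by simp
    qed
    then obtain c Z where Z: "infinite Z" "alternating c f' Z"
      and no: "\<forall>j. \<not> homogeneous f {y. reval (split_join Z) (from_nat j) [y] 1}"
      using f[rule_format, of f' "to_nat q"] f'(1) by blast
    have "\<not> homogeneous f K" if K: "K \<le>\<^sub>T split_join Z" for K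
    proof -
      obtain r where r: "\<forall>x. reval (split_join Z) r [x] (if x \<in> K then 1 else 0)"
        using K unfolding turing_le_def by blast
      have "reval (split_join Z) r [y] 1 \<longleftrightarrow> y \<in> K" for y
        using r[rule_format, of y] reval_unique[of "split_join Z" r "[y]" 1 0] by (auto split: if_splits)
      then have "K = {y. reval (split_join Z) (from_nat (to_nat r)) [y] 1}" by simp
      then show ?thesis using no by metis
    qed
    then show ?thesis using alternating_p_homogeneous[OF Z] by blast
  qed
  \<comment> \<open>With the empty family clause (i) is vacuous, and every stable \<open>f'\<close>
    falls under the second alternative of (ii).\<close>
  then show ?thesis using \<open>stable f\<close> by (intro exI[of _ f] exI[of _ "{}"]) blast
qed

end
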